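(* Let $N_0,N_1\ge 1$ be integers, let $\Sigma_x\in\mathbb{R}^{N_0\times N_0}$ be positive definite with eigenvalues $\lambda^x_1\ge\cdots\ge\lambda^x_{N_0}>0$, and let $\sigma^2>0$. Let $X\sim\mathcal{N}(0;\Sigma_x)$, and for $W\in\mathbb{R}^{N_1\times N_0}$, $b\in\mathbb{R}^{N_1}$ let $Z\mid X,W,b\sim\mathcal{N}(WX+b;\,\sigma^2 I_{N_1})$. Let $\tilde N=\min(N_0,N_1)$, let $K$ be an integer with $1\le K<\tilde N$, and let $F$ satisfy $\rho_{\tilde N-K}\le F\le\rho_{\tilde N-K+1}$. Then $$\mathrm{MMI}(X;Z)=\frac{\tilde N-K}{2}\log\!\left(\frac{F+\sigma^2\,\mathrm{Tr}(\Sigma_{x,\tilde N-K}^{-1})}{\sigma^2(\tilde N-K)}\right)+\frac12\log|\Sigma_{x,\tilde N-K}|.$$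
   Context: $\mathcal{N}(\mu;A)$ denotes the Gaussian distribution with mean $\mu$ and covariance $A$; logarithms are natural and $|\cdot|$ denotes determinant. For $k=1,\dots,\tilde N$, $\Sigma_{x,k}=\mathrm{diag}(\lambda^x_1,\dots,\lambda^x_k)$ and $\rho_k\triangleq\sigma^2\left(\frac{k}{\lambda^x_k}-\sum_{i=1}^k\frac{1}{\lambda^x_i}\right)$. $I_{W,b}(X;Z)$ is the mutual information between $X$ and $Z$ under the joint law determined by $W,b$, and $\mathrm{MMI}(X;Z)\triangleq\sup\{I_{W,b}(X;Z): W\in\mathbb{R}^{N_1\times N_0},\ b\in\mathbb{R}^{N_1},\ \mathrm{Tr}(W^TW)\le F\}$. *)

theory Defs
  imports "HOL-Analysis.Analysis" "HOL-Probability.Probability"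
begin

definition gauss_pdf :: "real^'n^'n \<Rightarrow> real^'n \<Rightarrow> real^'n \<Rightarrow> real" where
  "gauss_pdf C m x =
     exp (- (1/2) * ((x - m) \<bullet> (matrix_inv C *v (x - m))))
     / sqrt ((2 * pi) ^ CARD('n) * det C)"

definition joint_law :: "real^'n0^'n0 \<Rightarrow> real \<Rightarrow> real^'n0^'n1 \<Rightarrow> real^'n1
    \<Rightarrow> ((real^'n0) \<times> (real^'n1)) measure" where
  "joint_law Sx s2 W b =
     density (lborel \<Otimes>\<^sub>M lborel)
       (\<lambda>(x, z). ennreal (gauss_pdf Sx 0 x * gauss_pdf (s2 *\<^sub>R mat 1) (W *v x + b) z))"

definition MI_Wb :: "real^'n0^'n0 \<Rightarrow> real \<Rightarrow> real^'n0^'n1 \<Rightarrow> real^'n1 \<Rightarrow> real" where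
  "MI_Wb Sx s2 W b =
     prob_space.mutual_information (joint_law Sx s2 W b) (exp 1)
       (lborel :: (real^'n0) measure) (lborel :: (real^'n1) measure) fst snd"

definition MMI :: "real^'n0^'n0 \<Rightarrow> real \<Rightarrow> real \<Rightarrow> ('n1::finite) itself \<Rightarrow> real" where
  "MMI Sx s2 F (_ :: ('n1::finite) itself) =
     Sup {MI_Wb Sx s2 W b | (W :: real^'n0^'n1) (b :: real^'n1).
            trace (transpose W ** W) \<le> F}"

text \<open>rho_k = s2 (k / lam_k - sum_{i=1}^k 1/lam_i); eigenvalues indexed from 1.\<close>
definition rho :: "real \<Rightarrow> (nat \<Rightarrow> real) \<Rightarrow> nat \<Rightarrow> real" where
  "rho s2 lam k = s2 * (real k / lam k - (\<Sum>i=1..k. 1 / lam i))"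

text \<open>Tr(Sigma_{x,k}^{-1}) and |Sigma_{x,k}| for Sigma_{x,k} = diag(lam_1,...,lam_k).\<close>
definition tr_inv_Sigma_k :: "(nat \<Rightarrow> real) \<Rightarrow> nat \<Rightarrow> real" where
  "tr_inv_Sigma_k lam k = (\<Sum>i=1..k. 1 / lam i)"

definition det_Sigma_k :: "(nat \<Rightarrow> real) \<Rightarrow> nat \<Rightarrow> real" where
  "det_Sigma_k lam k = (\<Prod>i=1..k. lam i)"

end

(* For W fixed, the mutual information is 1/2 ln (det Sx * det (Sx^-1 + W^T W / s2)): writing the joint
   density as exp (- m / 2) times a function of z, with m the quadratic form of M = Sx^-1 + W^T W / s2
   centred at the conditional mean of x, the logarithm of the density ratio is a constant plus
   (x^T Sx^-1 x - m) / 2, and both quadratic forms have expectation N0.  This avoids the covariance of Z.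

   Put n = min N0 N1 - K and let c be the diagonal of Sx^-1 + W^T W / s2 at the water-filling optimum, in
   the eigenbasis of Sx.  The tangent plane of ln det at diag c bounds ln det M for every W in terms of
   the sum of M_ii / c_i; since c_i >= level / s2 for all i, the trace constraint makes this bound equal to
   the optimal value.  In particular no singular value decomposition of W is needed, and the rank
   restriction only matters for the existence of the optimal W, which has n < N1 nonzero rows. *)
theory Submission
  imports Defs
begin

subsection \<open>The spectral theorem and determinant bounds\<close>

text \<open>Two obstacles shape the development. The numbers \<open>lam\<close> are tied to
  \<open>Sx\<close> only as roots of its characteristic polynomial, so an orthonormal eigenbasis is
  constructed and then matched with \<open>lam\<close>, multiplicities included. The Gaussian
  exponents are not diagonal, so the integrals are rotated into an eigenbasis, which rests on the
  invariance of \<open>lborel\<close> under orthogonal maps.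

  The tangent plane at diag c acts as a Lagrangian certificate. Power spent in direction i raises it
  at rate \<open>1 / (s * c i)\<close>, which is \<open>1 / level\<close> in the active directions
  and at most that elsewhere. However the power is distributed, it therefore adds at most
  \<open>F / level\<close>, which is the amount that brings the exponent to 0.\<close>

lemma eigenvector_in_invariant_subspace:
  fixes f :: "'a::euclidean_space \<Rightarrow> 'a"
  assumes lin: "linear f" and sa: "\<And>x y. f x \<bullet> y = x \<bullet> f y"
    and V: "subspace V" and inv: "f ` V \<subseteq> V" and ne: "V \<noteq> {0}"
  obtains v c where "v \<in> V" "norm v = 1" "f v = c *\<^sub>R v"
proof -
  interpret linear f by fact
  have cpt: "compact (V \<inter> sphere 0 1)"
    by (simp add: closed_subspace[OF V] closed_Int_compact)
  obtain u where u: "u \<in> V" "u \<noteq> 0" using ne V subspace_0 by blast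
  have "u /\<^sub>R norm u \<in> V \<inter> sphere 0 1"
    using u V by (simp add: subspace_scale)
  then have nonempty: "V \<inter> sphere 0 1 \<noteq> {}" by blast
  have cont: "continuous_on (V \<inter> sphere 0 1) (\<lambda>x. x \<bullet> f x)"
    by (intro continuous_intros linear_continuous_on linear_conv_bounded_linear[THEN iffD1] lin)
  \<comment> \<open>A unit vector of \<open>V\<close> maximising the Rayleigh quotient will be the
    eigenvector, with the maximum \<open>m\<close> as eigenvalue.\<close>
  obtain v where v: "v \<in> V \<inter> sphere 0 1"
    and max: "\<And>y. y \<in> V \<inter> sphere 0 1 \<Longrightarrow> y \<bullet> f y \<le> v \<bullet> f v"
    using continuous_attains_sup[OF cpt nonempty cont] by blast
  define m where "m = v \<bullet> f v"
  have vV: "v \<in> V" and nv: "norm v = 1" using v by auto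
  have vv: "v \<bullet> v = 1" using nv by (simp add: norm_eq_1)
  have bound: "y \<bullet> f y \<le> m * (y \<bullet> y)" if "y \<in> V" for y
  proof (cases "y = 0")
    case False
    have "y /\<^sub>R norm y \<in> V \<inter> sphere 0 1" using that False V by (simp add: subspace_scale)
    from max[OF this] have "(y \<bullet> f y) / (norm y)\<^sup>2 \<le> m"
      by (simp add: m_def scaleR power2_eq_square field_simps)
    then show ?thesis using False by (simp add: divide_le_eq dot_square_norm mult.commute)
  qed (simp add: zero)
  \<comment> \<open>The first variation of the Rayleigh quotient vanishes at the maximiser.\<close>
  have ortho: "w \<bullet> f v = 0" if wV: "w \<in> V" and wv: "v \<bullet> w = 0" for w
  proof -
    have quad: "2 * t * (w \<bullet> f v) \<le> t\<^sup>2 * (m * (w \<bullet> w) - w \<bullet> f w)" for t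
    proof -
      have "v + t *\<^sub>R w \<in> V" using vV wV V by (simp add: subspace_add subspace_scale)
      from bound[OF this]
      have "m + 2 * t * (w \<bullet> f v) + t\<^sup>2 * (w \<bullet> f w) \<le> m * (1 + t\<^sup>2 * (w \<bullet> w))"
        using wv sa[of v w] vv
        by (simp add: add scaleR inner_add_left inner_add_right m_def inner_commute
            power2_eq_square algebra_simps)
      then show ?thesis by (simp add: algebra_simps)
    qed
    define a where "a = w \<bullet> f v"
    \<comment> \<open>By \<open>quad\<close> a linear term in \<open>t\<close> stays below a
      quadratic one for every \<open>t\<close>, which forces \<open>a = 0\<close>. The choice
      \<open>t = a / k\<close> makes this explicit; the \<open>+ 1\<close> keeps \<open>k\<close>
      positive.\<close>
    define k where "k = \<bar>m * (w \<bullet> w) - w \<bullet> f w\<bar> + 1"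
    have k: "k > 0" by (simp add: k_def)
    have "2 * (a / k) * a \<le> (a / k)\<^sup>2 * (m * (w \<bullet> w) - w \<bullet> f w)"
      using quad[of "a / k"] by (simp add: a_def)
    also have "\<dots> \<le> (a / k)\<^sup>2 * k" by (intro mult_left_mono) (auto simp: k_def)
    finally have "2 * a\<^sup>2 \<le> a\<^sup>2" using k by (simp add: power2_eq_square field_simps)
    then show ?thesis by (simp add: a_def)
  qed
  \<comment> \<open>The part of \<open>f v\<close> orthogonal to \<open>v\<close> is itself an
    admissible direction for \<open>ortho\<close>, hence orthogonal to \<open>f v\<close> and so to
    itself.\<close>
  define w where "w = f v - m *\<^sub>R v"
  have wV: "w \<in> V" unfolding w_def using inv vV V by (intro subspace_diff subspace_scale) auto
  have wv: "v \<bullet> w = 0" by (simp add: w_def inner_diff_right m_def vv)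
  have "w \<bullet> w = w \<bullet> (f v - m *\<^sub>R v)" by (simp add: w_def)
  also have "\<dots> = w \<bullet> f v - m * (v \<bullet> w)" by (simp add: inner_diff_right inner_commute)
  also have "\<dots> = 0" using ortho[OF wV wv] wv by simp
  finally have "f v = m *\<^sub>R v" by (simp add: w_def)
  with vV nv that show ?thesis by blast
qed

text \<open>Induction on the dimension: one eigenvector is split off, and self-adjointness makes its
  orthogonal complement within \<open>V\<close> invariant again. Speaking of invariant subspaces
  rather than the whole space keeps \<open>f\<close> fixed throughout the induction.\<close>

lemma orthonormal_eigenbasis_of_invariant_subspace:
  fixes f :: "'a::euclidean_space \<Rightarrow> 'a"
  assumes lin: "linear f" and sa: "\<And>x y. f x \<bullet> y = x \<bullet> f y"
    and "subspace V" and "f ` V \<subseteq> V"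
  shows "\<exists>B. finite B \<and> B \<subseteq> V \<and> card B = dim V \<and> pairwise orthogonal B \<and>
    (\<forall>v\<in>B. norm v = 1 \<and> (\<exists>c. f v = c *\<^sub>R v))"
  using assms(3,4)
proof (induction "dim V" arbitrary: V)
  case 0
  then show ?case by (intro exI[of _ "{}"]) auto
next
  case (Suc n)
  interpret linear f by fact
  have "V \<noteq> {0}" using Suc.hyps by auto
  then obtain v c where v: "v \<in> V" "norm v = 1" "f v = c *\<^sub>R v"
    using eigenvector_in_invariant_subspace[OF lin sa Suc.prems] by blast
  define U where "U = {x \<in> V. v \<bullet> x = 0}"
  have "U = V \<inter> {x. v \<bullet> x = 0}" by (auto simp: U_def)
  then have U: "subspace U" using Suc.prems(1) by (simp add: subspace_hyperplane subspace_inter)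
  have fU: "f ` U \<subseteq> U"
  proof safe
    fix x assume x: "x \<in> U"
    have "v \<bullet> f x = f v \<bullet> x" by (simp add: sa)
    also have "\<dots> = 0" using x by (simp add: v U_def)
    finally show "f x \<in> U" using x Suc.prems by (auto simp: U_def)
  qed
  have sp: "span U = U" "span V = V" using U Suc.prems(1) by simp_all
  have "V = span (insert v U)"
  proof
    show "span (insert v U) \<subseteq> V"
      using v(1) Suc.prems(1) by (intro span_minimal) (auto simp: U_def)
    show "V \<subseteq> span (insert v U)"
    proof
      fix x assume x: "x \<in> V"
      have "x - (v \<bullet> x) *\<^sub>R v \<in> U"
        unfolding U_def mem_Collect_eq
      proof
        show "x - (v \<bullet> x) *\<^sub>R v \<in> V"
          by (intro subspace_diff subspace_scale Suc.prems(1) x v(1))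
        show "v \<bullet> (x - (v \<bullet> x) *\<^sub>R v) = 0"
          using v(2) by (simp add: inner_diff_right norm_eq_1)
      qed
      then have "x - (v \<bullet> x) *\<^sub>R v \<in> span U" by (rule span_base)
      then show "x \<in> span (insert v U)" unfolding span_insert by blast
    qed
  qed
  moreover have "v \<notin> U" using v by (auto simp: U_def norm_eq_1)
  ultimately have "dim V = Suc (dim U)" using sp by (metis dim_insert dim_span Suc_eq_plus1)
  then have "n = dim U" using Suc.hyps(2) by simp
  from Suc.hyps(1)[OF this U fU] obtain B where B: "finite B" "B \<subseteq> U" "card B = dim U"
    "pairwise orthogonal B" "\<forall>v\<in>B. norm v = 1 \<and> (\<exists>c. f v = c *\<^sub>R v)" by blast
  have "v \<notin> B" using B(2) \<open>v \<notin> U\<close> by blast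
  show ?case
  proof (intro exI[of _ "insert v B"] conjI)
    show "card (insert v B) = dim V" using B \<open>v \<notin> B\<close> \<open>dim V = Suc (dim U)\<close> by simp
    show "pairwise orthogonal (insert v B)"
      using B by (auto simp: pairwise_insert orthogonal_def U_def inner_commute)
    show "insert v B \<subseteq> V" using v B by (auto simp: U_def)
  qed (use B v in auto)
qed

text \<open>Vectors and coordinates share their index type, so such a family is automatically a
  basis and forms the rows of a square orthogonal matrix.\<close>

definition orthonormal_family :: "('n \<Rightarrow> real^'n) \<Rightarrow> bool" where
  "orthonormal_family e \<longleftrightarrow> (\<forall>i j. e i \<bullet> e j = (if i = j then 1 else 0))"

theorem symmetric_matrix_eigenbasis:
  fixes A :: "real^'n^'n"
  assumes "transpose A = A"
  obtains e d where "orthonormal_family e" "\<And>i. A *v e i = d i *\<^sub>R e i"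
proof -
  have sa: "(A *v x) \<bullet> y = x \<bullet> (A *v y)" for x y
    using assms by (metis dot_lmul_matrix vector_transpose_matrix)
  obtain B where B: "finite B" "card B = CARD('n)" "pairwise orthogonal B"
    "\<forall>v\<in>B. norm v = 1 \<and> (\<exists>c. A *v v = c *\<^sub>R v)"
    using orthonormal_eigenbasis_of_invariant_subspace[OF matrix_vector_mul_linear sa, of UNIV]
    by auto
  obtain e where e: "bij_betw e (UNIV :: 'n set) B"
    using finite_same_card_bij[of "UNIV :: 'n set" B] B by auto
  have eB: "e i \<in> B" for i using e by (auto simp: bij_betw_def)
  have "\<forall>i. \<exists>c. A *v e i = c *\<^sub>R e i" using B(4) eB by blast
  from choice[OF this] obtain d where d: "\<And>i. A *v e i = d i *\<^sub>R e i" by blast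
  have "e i \<bullet> e j = (if i = j then 1 else 0)" for i j
  proof (cases "i = j")
    case True
    then show ?thesis using B(4) eB by (simp add: norm_eq_1)
  next
    case False
    then have "e i \<noteq> e j" using e by (auto simp: bij_betw_def inj_on_def)
    then show ?thesis using B(3) eB False by (auto simp: pairwise_def orthogonal_def)
  qed
  then show ?thesis using that d by (auto simp: orthonormal_family_def)
qed

lemma orthonormal_family_matrix:
  assumes "orthonormal_family e"
  shows "orthogonal_matrix (\<chi> i. e i)"
  using assms unfolding orthogonal_matrix_orthonormal_rows
  by (auto simp: orthonormal_family_def row_def pairwise_def orthogonal_def norm_eq_1 vec_lambda_eta)

text \<open>Writing the matrix of \<open>A\<close> in the family \<open>e\<close> as a product gives
  access to multiplicativity of \<open>det\<close>, cyclicity of the trace and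
  transposition.\<close>

lemma conjugate_entries:
  fixes A :: "real^'n^'n" and e :: "'m::finite \<Rightarrow> real^'n"
  shows "(\<chi> i. e i) ** A ** transpose (\<chi> i. e i) = (\<chi> i j. e i \<bullet> (A *v e j))"
proof -
  have "((\<chi> i. e i) ** A ** transpose (\<chi> i. e i)) $ i $ j = e i \<bullet> (A *v e j)" for i j
    by (simp add: matrix_mul_assoc[symmetric])
       (simp add: matrix_matrix_mult_def matrix_vector_mult_def transpose_def inner_vec_def)
  then show ?thesis by (simp add: vec_eq_iff)
qed

lemma det_in_orthonormal_basis:
  fixes A :: "real^'n^'n"
  assumes "orthonormal_family e"
  shows "det (\<chi> i j. e i \<bullet> (A *v e j)) = det A"
proof -
  let ?Q = "(\<chi> i. e i) :: real^'n^'n"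
  have "det ?Q * det ?Q = 1"
    using det_orthogonal_matrix[OF orthonormal_family_matrix[OF assms]] by auto
  then show ?thesis
    by (simp add: conjugate_entries[symmetric] det_mul det_transpose)
qed

lemma trace_in_orthonormal_basis:
  fixes A :: "real^'n^'n"
  assumes "orthonormal_family e"
  shows "(\<Sum>i\<in>UNIV. e i \<bullet> (A *v e i)) = trace A"
proof -
  let ?Q = "(\<chi> i. e i) :: real^'n^'n"
  have "trace (?Q ** (A ** transpose ?Q)) = trace (A ** (transpose ?Q ** ?Q))"
    by (subst trace_mul_sym) (simp add: matrix_mul_assoc)
  also have "transpose ?Q ** ?Q = mat 1"
    using orthonormal_family_matrix[OF assms] by (simp add: orthogonal_matrix_def)
  finally have "trace (?Q ** A ** transpose ?Q) = trace A" by (simp add: matrix_mul_assoc)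
  then show ?thesis by (simp add: conjugate_entries) (simp add: trace_def)
qed

lemma orthonormal_family_expand:
  assumes "orthonormal_family e"
  shows "x = (\<Sum>i\<in>UNIV. (e i \<bullet> x) *\<^sub>R e i)"
proof -
  let ?Q = "\<chi> i. e i"
  have "x = transpose ?Q *v (?Q *v x)"
    using orthonormal_family_matrix[OF assms]
    by (simp add: matrix_vector_mul_assoc orthogonal_matrix_def)
  also have "\<dots> = (\<Sum>i\<in>UNIV. (e i \<bullet> x) *\<^sub>R e i)"
    by (simp add: vec_eq_iff matrix_vector_mult_def transpose_def inner_vec_def mult.commute)
  finally show ?thesis .
qed

lemma quadratic_form_eigenbasis:
  assumes e: "orthonormal_family e" and d: "\<And>i. A *v e i = d i *\<^sub>R e i"
  shows "x \<bullet> (A *v x) = (\<Sum>i\<in>UNIV. d i * (e i \<bullet> x)\<^sup>2)"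
proof -
  have "A *v x = A *v (\<Sum>i\<in>UNIV. (e i \<bullet> x) *\<^sub>R e i)"
    using orthonormal_family_expand[OF e, of x] by simp
  also have "\<dots> = (\<Sum>i\<in>UNIV. (d i * (e i \<bullet> x)) *\<^sub>R e i)"
    by (simp add: linear_sum[OF matrix_vector_mul_linear] linear_scale[OF matrix_vector_mul_linear] d
        mult.commute)
  finally show ?thesis by (simp add: inner_sum_right power2_eq_square inner_commute mult.assoc)
qed

lemma det_eigenbasis:
  fixes A :: "real^'n^'n"
  assumes e: "orthonormal_family e" and d: "\<And>i. A *v e i = d i *\<^sub>R e i"
  shows "det A = (\<Prod>i\<in>UNIV. d i)"
proof -
  have "det A = det (\<chi> i j. e i \<bullet> (A *v e j))" using det_in_orthonormal_basis[OF e] by simp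
  also have "\<dots> = (\<Prod>i\<in>UNIV. d i)"
    using e by (subst det_diagonal) (auto simp: d orthonormal_family_def)
  finally show ?thesis .
qed

text \<open>Every eigenvalue \<open>d\<close> satisfies \<open>0 \<le> d\<close> and
  \<open>d \<le> exp (d - 1)\<close>, and these inequalities multiply. This is the tangent plane of
  the log-determinant at the identity, in a form that also covers singular \<open>A\<close>.\<close>

lemma det_le_exp_trace:
  fixes A :: "real^'n^'n"
  assumes "transpose A = A" and psd: "\<And>x. 0 \<le> x \<bullet> (A *v x)"
  shows "det A \<le> exp (trace A - CARD('n))"
proof -
  obtain e d where e: "orthonormal_family e" and d: "\<And>i. A *v e i = d i *\<^sub>R e i"
    using symmetric_matrix_eigenbasis[OF assms(1)] by blast
  have ed: "e i \<bullet> (A *v e i) = d i" for i using e by (simp add: d orthonormal_family_def)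
  have "det A = (\<Prod>i\<in>UNIV. d i)" by (rule det_eigenbasis[OF e d])
  also have "\<dots> \<le> (\<Prod>i\<in>UNIV. exp (d i - 1))"
    using psd exp_ge_add_one_self by (intro prod_mono) (smt (verit) ed)
  also have "\<dots> = exp (trace A - CARD('n))"
    by (simp add: exp_sum[symmetric] sum_subtractf trace_in_orthonormal_basis[OF e, symmetric] ed)
  finally show ?thesis .
qed

text \<open>Tangent-plane form of the concavity of \<open>ln \<circ> det\<close> at the diagonal matrix with entries \<open>c\<close>;
  the choice \<open>c i = B $ i $ i\<close> is Hadamard's inequality.\<close>
lemma det_le_diagonal:
  fixes B :: "real^'n^'n" and c :: "'n \<Rightarrow> real"
  assumes sym: "transpose B = B" and psd: "\<And>x. 0 \<le> x \<bullet> (B *v x)" and c: "\<And>i. c i > 0"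
  shows "det B \<le> (\<Prod>i\<in>UNIV. c i) * exp ((\<Sum>i\<in>UNIV. B $ i $ i / c i) - CARD('n))"
proof -
  \<comment> \<open>Conjugation by \<open>D\<close> moves the point of tangency from diag c to the
    identity and preserves symmetry and semidefiniteness.\<close>
  define D :: "real^'n^'n" where "D = (\<chi> i j. if i = j then 1 / sqrt (c i) else 0)"
  define A where "A = D ** B ** D"
  have tD: "transpose D = D" by (auto simp: D_def transpose_def vec_eq_iff)
  have entries: "A $ i $ j = B $ i $ j / (sqrt (c i) * sqrt (c j))" for i j
    by (simp add: A_def D_def matrix_matrix_mult_def if_distrib[of "\<lambda>x. _ * x"] if_distrib[of "\<lambda>x. x * _"]
       cong: if_cong)
  have "transpose A = A" by (simp add: A_def matrix_transpose_mul tD sym matrix_mul_assoc)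
  moreover have "0 \<le> x \<bullet> (A *v x)" for x
  proof -
    have "x \<bullet> (A *v x) = x \<bullet> (D *v (B *v (D *v x)))"
      by (simp add: A_def matrix_vector_mul_assoc matrix_mul_assoc)
    also have "\<dots> = (D *v x) \<bullet> (B *v (D *v x))"
      by (metis dot_lmul_matrix vector_transpose_matrix tD)
    finally show ?thesis using psd by simp
  qed
  ultimately have "det A \<le> exp (trace A - CARD('n))" by (rule det_le_exp_trace)
  moreover have "trace A = (\<Sum>i\<in>UNIV. B $ i $ i / c i)"
    using c by (simp add: trace_def entries less_imp_le)
  moreover have "det A = det B / (\<Prod>i\<in>UNIV. c i)"
  proof -
    have "det D = (\<Prod>i\<in>UNIV. 1 / sqrt (c i))"
      by (subst det_diagonal) (auto simp: D_def)
    then have "det D * det D = (\<Prod>i\<in>UNIV. 1 / c i)"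
      using c by (simp add: prod.distrib[symmetric] less_imp_le)
    then show ?thesis
      by (simp add: A_def det_mul prod_dividef) (metis mult.assoc mult.commute mult_1 times_divide_eq_left)
  qed
  moreover have "(\<Prod>i\<in>UNIV. c i) > 0" using c by (simp add: prod_pos)
  ultimately show ?thesis by (simp add: divide_le_eq mult.commute)
qed

subsection \<open>Gaussian integrals\<close>

text \<open>Uniqueness of Haar measure, by Fubini: exchanging a translation between the image measure and
  \<open>lborel\<close> compares both against the unit ball, which the orthogonal map preserves.\<close>
lemma lborel_distr_orthogonal_transformation:
  fixes T :: "'a::euclidean_space \<Rightarrow> 'a"
  assumes T: "orthogonal_transformation T"
  shows "distr lborel borel T = lborel"
proof -
  have linT: "linear T" using T by (simp add: orthogonal_transformation_def)
  have [measurable]: "T \<in> borel_measurable borel"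
    using linT by (intro borel_measurable_continuous_onI linear_continuous_on)
      (simp add: linear_conv_bounded_linear)
  have surjT: "surj T" using T by (rule orthogonal_transformation_surj)
  define \<mu> where "\<mu> = distr lborel borel T"
  have [measurable_cong]: "sets \<mu> = sets borel" by (simp add: \<mu>_def)
  have shift_l: "(\<integral>\<^sup>+x. f (a + x) \<partial>lborel) = (\<integral>\<^sup>+x. f x \<partial>lborel)"
    if [measurable]: "f \<in> borel_measurable borel" for f and a :: 'a
    by (subst (2) lborel_distr_plus[of a, symmetric]) (simp add: nn_integral_distr)
  have nn_mu: "(\<integral>\<^sup>+x. f x \<partial>\<mu>) = (\<integral>\<^sup>+x. f (T x) \<partial>lborel)"
    if [measurable]: "f \<in> borel_measurable borel" for f
    by (simp add: \<mu>_def nn_integral_distr)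
  have shift_m: "(\<integral>\<^sup>+x. f (a + x) \<partial>\<mu>) = (\<integral>\<^sup>+x. f x \<partial>\<mu>)"
    if [measurable]: "f \<in> borel_measurable borel" for f a
  proof -
    obtain b where b: "a = T b" using surjT by auto
    have "(\<integral>\<^sup>+x. f (a + x) \<partial>\<mu>) = (\<integral>\<^sup>+x. f (T (b + x)) \<partial>lborel)"
      by (simp add: nn_mu b linear_add[OF linT])
    also have "\<dots> = (\<integral>\<^sup>+x. f x \<partial>\<mu>)"
      by (subst shift_l[of "\<lambda>x. f (T x)"]) (simp_all add: nn_mu)
    finally show ?thesis .
  qed
  \<comment> \<open>The unit ball is preserved by \<open>T\<close> and by reflection in the origin,
    and its volume \<open>G\<close> is positive and finite, so \<open>G\<close> can be
    cancelled.\<close>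
  define g :: "'a \<Rightarrow> ennreal" where "g = indicator (ball 0 1)"
  have [measurable]: "g \<in> borel_measurable borel"
    unfolding g_def by (intro borel_measurable_indicator) simp
  have g_minus: "g (- x) = g x" for x by (simp add: g_def indicator_def)
  have g_T: "g (T x) = g x" for x
    using T by (simp add: g_def indicator_def orthogonal_transformation_norm)
  define G where "G = (\<integral>\<^sup>+x. g x \<partial>lborel)"
  have G: "G = emeasure lborel (ball (0::'a) 1)" by (simp add: G_def g_def)
  have Gfin: "G \<noteq> \<infinity>" unfolding G using emeasure_lborel_ball_finite[of "0::'a" 1] by (simp add: less_top)
  have G0: "G \<noteq> 0"
  proof
    assume "G = 0"
    then have "ball (0::'a) 1 \<in> null_sets lborel" by (simp add: G null_sets_def)
    then show False
      using open_not_negligible[of "ball (0::'a) 1"]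
      by (simp add: negligible_iff_null_sets null_sets_completionI)
  qed
  have mu_g: "(\<integral>\<^sup>+x. g x \<partial>\<mu>) = G" by (simp add: nn_mu g_T G_def)
  \<comment> \<open>The argument of \<open>f\<close> is shifted by \<open>y\<close>; after an
    exchange of integrals, a translation by \<open>T x\<close> transfers the shift to
    \<open>g\<close>, whose \<open>\<mu>\<close>-integral is \<open>G\<close> for every
    shift.\<close>
  have inter: "(\<integral>\<^sup>+x. f x \<partial>\<mu>) = (\<integral>\<^sup>+x. f x \<partial>lborel)"
    if [measurable]: "f \<in> borel_measurable borel" for f
  proof -
    have "(\<integral>\<^sup>+x. f x \<partial>\<mu>) * G = (\<integral>\<^sup>+y. (\<integral>\<^sup>+x. f x * g y \<partial>\<mu>) \<partial>lborel)"
      by (simp add: nn_integral_cmult nn_integral_multc G_def)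
    also have "\<dots> = (\<integral>\<^sup>+y. (\<integral>\<^sup>+x. f (y + x) * g y \<partial>\<mu>) \<partial>lborel)"
    proof (rule nn_integral_cong)
      fix y
      show "(\<integral>\<^sup>+x. f x * g y \<partial>\<mu>) = (\<integral>\<^sup>+x. f (y + x) * g y \<partial>\<mu>)"
        using shift_m[of "\<lambda>x. f x * g y" y] by simp
    qed
    also have "\<dots> = (\<integral>\<^sup>+y. (\<integral>\<^sup>+x. f (y + T x) * g y \<partial>lborel) \<partial>lborel)"
      by (rule nn_integral_cong, rule nn_mu) auto
    also have "\<dots> = (\<integral>\<^sup>+x. (\<integral>\<^sup>+y. f (y + T x) * g y \<partial>lborel) \<partial>lborel)"
      by (rule lborel_pair.Fubini') measurable
    also have "\<dots> = (\<integral>\<^sup>+x. (\<integral>\<^sup>+y. f y * g (y - T x) \<partial>lborel) \<partial>lborel)"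
    proof (rule nn_integral_cong)
      fix x
      show "(\<integral>\<^sup>+y. f (y + T x) * g y \<partial>lborel) = (\<integral>\<^sup>+y. f y * g (y - T x) \<partial>lborel)"
        using shift_l[of "\<lambda>y. f y * g (y - T x)" "T x"] by (simp add: add.commute)
    qed
    also have "\<dots> = (\<integral>\<^sup>+y. (\<integral>\<^sup>+x. f y * g (y - T x) \<partial>lborel) \<partial>lborel)"
      by (rule lborel_pair.Fubini') measurable
    also have "\<dots> = (\<integral>\<^sup>+y. f y * G \<partial>lborel)"
    proof (rule nn_integral_cong)
      fix y
      have "(\<integral>\<^sup>+x. f y * g (y - T x) \<partial>lborel) = f y * (\<integral>\<^sup>+x. g (- y + x) \<partial>\<mu>)"
        using g_minus[of "y - T _"] by (simp add: nn_integral_cmult nn_mu)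
      then show "(\<integral>\<^sup>+x. f y * g (y - T x) \<partial>lborel) = f y * G" using shift_m[of g "- y"] mu_g by simp
    qed
    also have "\<dots> = (\<integral>\<^sup>+y. f y \<partial>lborel) * G" by (simp add: nn_integral_multc)
    finally show ?thesis using G0 Gfin
      by (simp add: ennreal_mult_cancel_left mult.commute[of _ G])
  qed
  have "\<mu> = lborel"
  proof (rule measure_eqI)
    fix A assume "A \<in> sets \<mu>"
    then have A: "A \<in> sets borel" by (simp add: \<mu>_def)
    then show "emeasure \<mu> A = emeasure lborel A"
      using inter[of "indicator A"] by (simp add: \<mu>_def)
  qed (simp add: \<mu>_def)
  then show ?thesis by (simp add: \<mu>_def)
qed

text \<open>The rotation with rows \<open>e i\<close> turns the inner products into coordinates and
  leaves \<open>lborel\<close> invariant, so the coordinatewise Fubini theorem applies.\<close>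

lemma nn_integral_lborel_prod_orthonormal:
  fixes f :: "'n::finite \<Rightarrow> real \<Rightarrow> ennreal"
  assumes e: "orthonormal_family e" and [measurable]: "\<And>i. f i \<in> borel_measurable borel"
  shows "(\<integral>\<^sup>+x. (\<Prod>i\<in>UNIV. f i (e i \<bullet> x)) \<partial>lborel) = (\<Prod>i\<in>UNIV. \<integral>\<^sup>+u. f i u \<partial>lborel)"
proof -
  let ?Q = "(\<chi> i. e i) :: real^'n^'n"
  have Qi: "(?Q *v x) $ i = e i \<bullet> x" for x i
    by (simp add: matrix_vector_mult_def inner_vec_def)
  have orth: "orthogonal_transformation ((*v) ?Q)"
    using orthonormal_family_matrix[OF e] by (simp add: orthogonal_transformation_matrix)
  have Qm: "(*v) ?Q \<in> borel_measurable lborel"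
    unfolding measurable_lborel2
    by (intro borel_measurable_continuous_onI matrix_vector_mult_linear_continuous_on)
  \<comment> \<open>The product rule for \<open>lborel\<close> indexes its factors by basis vectors;
    \<open>k\<close> recovers the coordinate from its axis vector.\<close>
  define k where "k = (\<lambda>b::real^'n. THE i. b = axis i 1)"
  have k: "k (axis i 1) = i" for i
    unfolding k_def by (rule the_equality) (auto simp: axis_eq_axis)
  have Basis: "(Basis :: (real^'n) set) = range (\<lambda>i. axis i 1)" by (auto simp: Basis_vec_def)
  have inj: "inj (\<lambda>i. axis i 1 :: real^'n)" by (auto simp: inj_on_def axis_eq_axis)
  have Basis_prod: "(\<Prod>b\<in>Basis. h b) = (\<Prod>i\<in>UNIV. h (axis i 1))" for h :: "real^'n \<Rightarrow> ennreal"
    unfolding Basis by (subst prod.reindex[OF inj]) (simp only: o_def)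
  have "(\<integral>\<^sup>+x. (\<Prod>i\<in>UNIV. f i (e i \<bullet> x)) \<partial>lborel)
      = (\<integral>\<^sup>+y. (\<Prod>i\<in>UNIV. f i (y $ i)) \<partial>distr lborel borel ((*v) ?Q))"
    by (subst nn_integral_distr[OF Qm]) (auto simp: Qi)
  also have "\<dots> = (\<integral>\<^sup>+y. (\<Prod>b\<in>Basis. f (k b) (y \<bullet> b)) \<partial>(lborel :: (real^'n) measure))"
    unfolding lborel_distr_orthogonal_transformation[OF orth]
    by (simp only: Basis_prod k inner_axis inner_real_def mult_1_right)
  also have "\<dots> = (\<Prod>b\<in>Basis. \<integral>\<^sup>+u. f (k b) u \<partial>lborel)"
    by (rule nn_integral_lborel_prod) auto
  also have "\<dots> = (\<Prod>i\<in>UNIV. \<integral>\<^sup>+u. f i u \<partial>lborel)"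
    by (simp only: Basis_prod k)
  finally show ?thesis .
qed

text \<open>These are the moments of order 0 and 2 of the normal density with standard deviation
  \<open>1 / sqrt d\<close>. They have the same value because \<open>d * u\<^sup>2\<close> has mean
  1 under it.\<close>

lemma gaussian_integral_real:
  assumes "d > 0"
  shows "(\<integral>\<^sup>+u. ennreal (exp (- (d * u\<^sup>2) / 2)) \<partial>lborel) = ennreal (sqrt (2 * pi / d))"
    and "(\<integral>\<^sup>+u. ennreal (d * u\<^sup>2 * exp (- (d * u\<^sup>2) / 2)) \<partial>lborel) = ennreal (sqrt (2 * pi / d))"
proof -
  have \<sigma>: "1 / sqrt d > 0" using assms by simp
  have nd: "normal_density 0 (1 / sqrt d) u = exp (- (d * u\<^sup>2) / 2) / sqrt (2 * pi / d)" for u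
    using assms by (simp add: normal_density_def field_simps)
  have c: "sqrt (2 * pi / d) \<noteq> 0" using assms by simp
  have "has_bochner_integral lborel (\<lambda>u. exp (- (d * u\<^sup>2) / 2) / sqrt (2 * pi / d)) 1"
    using normal_moment_even[OF \<sigma>, of 0 0] by (simp add: nd)
  from has_bochner_integral_mult_left[OF this, of "sqrt (2 * pi / d)"]
  have "has_bochner_integral lborel (\<lambda>u. exp (- (d * u\<^sup>2) / 2)) (sqrt (2 * pi / d))"
    using c by simp
  then show "(\<integral>\<^sup>+u. ennreal (exp (- (d * u\<^sup>2) / 2)) \<partial>lborel) = ennreal (sqrt (2 * pi / d))"
    by (simp add: has_bochner_integral_iff nn_integral_eq_integral)
  have "has_bochner_integral lborel (\<lambda>u. exp (- (d * u\<^sup>2) / 2) / sqrt (2 * pi / d) * u\<^sup>2) (1 / d)"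
    using normal_moment_even[OF \<sigma>, of 0 1] assms by (simp add: nd power_divide numeral_2_eq_2)
  from has_bochner_integral_mult_left[OF this, of "d * sqrt (2 * pi / d)"]
  have "has_bochner_integral lborel (\<lambda>u. d * u\<^sup>2 * exp (- (d * u\<^sup>2) / 2)) (sqrt (2 * pi / d))"
    using c assms by (simp add: mult_ac)
  then show "(\<integral>\<^sup>+u. ennreal (d * u\<^sup>2 * exp (- (d * u\<^sup>2) / 2)) \<partial>lborel) = ennreal (sqrt (2 * pi / d))"
    using assms by (simp add: has_bochner_integral_iff nn_integral_eq_integral)
qed

text \<open>In an eigenbasis the exponential factorises into one-dimensional Gaussians. The
  quadratic form is a sum of \<open>CARD('n)\<close> terms, each of mean 1 under the normalised
  density, whence the extra factor in the second integral.\<close>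

lemma gaussian_integral:
  fixes A :: "real^'n^'n" and a :: "real^'n"
  assumes sym: "transpose A = A" and pd: "\<And>x. x \<noteq> 0 \<Longrightarrow> 0 < x \<bullet> (A *v x)"
  shows "(\<integral>\<^sup>+x. ennreal (exp (- ((x - a) \<bullet> (A *v (x - a))) / 2)) \<partial>lborel)
      = ennreal (sqrt ((2 * pi) ^ CARD('n) / det A))" (is "?thesis1")
    and "(\<integral>\<^sup>+x. ennreal ((x - a) \<bullet> (A *v (x - a)) * exp (- ((x - a) \<bullet> (A *v (x - a))) / 2)) \<partial>lborel)
      = ennreal (CARD('n) * sqrt ((2 * pi) ^ CARD('n) / det A))" (is "?thesis2")
    and "det A > 0"
proof -
  obtain e d where e: "orthonormal_family e" and ed: "\<And>i. A *v e i = d i *\<^sub>R e i"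
    using symmetric_matrix_eigenbasis[OF sym] by blast
  have d: "d i > 0" for i
  proof -
    have ee: "e i \<bullet> e i = 1" using e by (simp add: orthonormal_family_def)
    then have "e i \<noteq> 0" by auto
    from pd[OF this] show ?thesis by (simp add: ed ee)
  qed
  define q where "q x = x \<bullet> (A *v x)" for x
  have q: "q x = (\<Sum>i\<in>UNIV. d i * (e i \<bullet> x)\<^sup>2)" for x
    unfolding q_def by (rule quadratic_form_eigenbasis[OF e ed])
  have detA: "det A = (\<Prod>i\<in>UNIV. d i)" by (rule det_eigenbasis[OF e ed])
  then show "det A > 0" using d by (simp add: prod_pos)
  define C where "C = (\<Prod>i\<in>UNIV. sqrt (2 * pi / d i))"
  have "C = sqrt (\<Prod>i\<in>UNIV. 2 * pi / d i)"
    using d by (intro real_sqrt_unique[symmetric])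
      (auto simp: C_def prod_power_distrib less_imp_le intro!: prod_nonneg)
  also have "\<dots> = sqrt ((2 * pi) ^ CARD('n) / det A)" by (simp add: detA prod_dividef)
  finally have C: "C = sqrt ((2 * pi) ^ CARD('n) / det A)" .
  have shift: "(\<integral>\<^sup>+x. f (x - a) \<partial>lborel) = (\<integral>\<^sup>+x. f x \<partial>lborel)"
    if [measurable]: "f \<in> borel_measurable borel" for f :: "real^'n \<Rightarrow> ennreal"
    by (subst (2) lborel_distr_plus[of "-a", symmetric]) (simp add: nn_integral_distr)
  have [measurable]: "q \<in> borel_measurable borel" by (simp add: q[abs_def])
  have exp_q: "ennreal (exp (- q x / 2)) = (\<Prod>i\<in>UNIV. ennreal (exp (- (d i * (e i \<bullet> x)\<^sup>2) / 2)))" for x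
    by (simp add: q prod_ennreal exp_sum[symmetric] sum_negf sum_divide_distrib[symmetric])
  have I1: "(\<integral>\<^sup>+x. ennreal (exp (- q x / 2)) \<partial>lborel) = ennreal C"
    unfolding exp_q
    by (subst nn_integral_lborel_prod_orthonormal[OF e])
       (simp_all add: gaussian_integral_real(1)[OF d, simplified] prod_ennreal C_def less_imp_le d)
  show ?thesis1
    unfolding q_def[symmetric] C[symmetric] I1[symmetric] by (rule shift) measurable
  \<comment> \<open>\<open>F i j\<close> is the factor in coordinate \<open>j\<close> of the
    \<open>i\<close>-th summand: only coordinate \<open>i\<close> carries the second moment.\<close>
  define F where "F i j u = (if j = i then d j * u\<^sup>2 * exp (- (d j * u\<^sup>2) / 2) else exp (- (d j * u\<^sup>2) / 2))"
    for i j u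
  have F0: "F i j u \<ge> 0" for i j u using d[THEN less_imp_le] by (simp add: F_def)
  have F: "(\<Prod>j\<in>UNIV. F i j (e j \<bullet> x)) = d i * (e i \<bullet> x)\<^sup>2 * exp (- q x / 2)" for i x
  proof -
    have "(\<Prod>j\<in>UNIV. F i j (e j \<bullet> x))
        = F i i (e i \<bullet> x) * (\<Prod>j\<in>UNIV - {i}. F i j (e j \<bullet> x))"
      by (rule prod.remove) auto
    also have "(\<Prod>j\<in>UNIV - {i}. F i j (e j \<bullet> x)) = (\<Prod>j\<in>UNIV - {i}. exp (- (d j * (e j \<bullet> x)\<^sup>2) / 2))"
      by (intro prod.cong) (auto simp: F_def)
    also have "F i i (e i \<bullet> x) * \<dots> = d i * (e i \<bullet> x)\<^sup>2 * (\<Prod>j\<in>UNIV. exp (- (d j * (e j \<bullet> x)\<^sup>2) / 2))"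
      by (subst (2) prod.remove[of _ i]) (auto simp: F_def)
    also have "\<dots> = d i * (e i \<bullet> x)\<^sup>2 * exp (- q x / 2)"
      by (simp add: q exp_sum[symmetric] sum_negf sum_divide_distrib[symmetric])
    finally show ?thesis .
  qed
  have F_int: "(\<integral>\<^sup>+u. ennreal (F i j u) \<partial>lborel) = ennreal (sqrt (2 * pi / d j))" for i j
    by (cases "j = i") (simp_all add: F_def gaussian_integral_real[OF d, simplified])
  have [measurable]: "F i j \<in> borel_measurable borel" for i j by (simp add: F_def[abs_def])
  have I2: "(\<integral>\<^sup>+x. ennreal (q x * exp (- q x / 2)) \<partial>lborel) = ennreal (CARD('n) * C)"
  proof -
    have "ennreal (q x * exp (- q x / 2)) = (\<Sum>i\<in>UNIV. \<Prod>j\<in>UNIV. ennreal (F i j (e j \<bullet> x)))" for x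
    proof -
      have "q x * exp (- q x / 2) = (\<Sum>i\<in>UNIV. \<Prod>j\<in>UNIV. F i j (e j \<bullet> x))"
        by (simp add: F sum_distrib_right[symmetric]) (simp add: q)
      then show ?thesis using F0 by (simp add: sum_ennreal prod_ennreal prod_nonneg)
    qed
    then have "(\<integral>\<^sup>+x. ennreal (q x * exp (- q x / 2)) \<partial>lborel)
        = (\<Sum>i\<in>UNIV. \<integral>\<^sup>+x. (\<Prod>j\<in>UNIV. ennreal (F i j (e j \<bullet> x))) \<partial>lborel)"
      by (simp add: nn_integral_sum)
    also have "\<dots> = (\<Sum>i\<in>(UNIV::'n set). ennreal C)"
      by (intro sum.cong refl, subst nn_integral_lborel_prod_orthonormal[OF e])
         (simp_all add: F_int prod_ennreal C_def less_imp_le d)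
    also have "\<dots> = ennreal (CARD('n) * C)"
      by (simp add: ennreal_mult ennreal_of_nat_eq_real_of_nat C_def prod_nonneg less_imp_le d)
    finally show ?thesis .
  qed
  show ?thesis2
    unfolding q_def[symmetric] C[symmetric] I2[symmetric] by (rule shift) measurable
qed

section \<open>Inverses of positive definite matrices and completion of the square\<close>

lemma matrix_vector_inner_transpose:
  fixes A :: "real^'n^'m"
  shows "x \<bullet> (A *v y) = (transpose A *v x) \<bullet> y"
  using dot_lmul_matrix[of x A y] vector_transpose_matrix[of x "transpose A"] by simp

lemma inner_vector_matrix_mult:
  fixes A :: "real^'n^'m"
  shows "x \<bullet> (y v* A) = (A *v x) \<bullet> y"
  by (metis dot_lmul_matrix inner_commute)

lemma posdef_invertible:
  fixes A :: "real^'n^'n"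
  assumes "\<And>x. x \<noteq> 0 \<Longrightarrow> 0 < x \<bullet> (A *v x)"
  shows "invertible A"
  unfolding invertible_left_inverse matrix_left_invertible_ker
  using assms by (metis inner_zero_right less_irrefl)

lemma matrix_inv_mult:
  fixes A :: "real^'n^'n"
  assumes "invertible A"
  shows matrix_inv_right: "A ** matrix_inv A = mat 1" and matrix_inv_left: "matrix_inv A ** A = mat 1"
  using someI_ex[OF assms[unfolded invertible_def]] unfolding matrix_inv_def by auto

lemma matrix_inv_unique:
  fixes A :: "real^'n^'n"
  assumes "A ** B = mat 1"
  shows "matrix_inv A = B"
proof -
  have "invertible A" using assms invertible_right_inverse by blast
  then have "matrix_inv A ** (A ** B) = B" by (simp add: matrix_mul_assoc matrix_inv_left)
  then show ?thesis by (simp add: assms)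
qed

lemma matrix_inv_cancel:
  fixes A :: "real^'n^'n"
  assumes "invertible A"
  shows "A *v (matrix_inv A *v x) = x" "matrix_inv A *v (A *v x) = x"
  using assms by (simp_all add: matrix_vector_mul_assoc matrix_inv_mult)

lemma matrix_inv_symmetric:
  fixes A :: "real^'n^'n"
  assumes "transpose A = A" "invertible A"
  shows "transpose (matrix_inv A) = matrix_inv A"
proof -
  have "A ** transpose (matrix_inv A) = transpose (matrix_inv A ** A)"
    by (simp add: matrix_transpose_mul assms(1))
  also have "\<dots> = mat 1" by (simp add: matrix_inv_left assms(2) transpose_mat)
  finally show ?thesis by (rule matrix_inv_unique[symmetric])
qed

lemma matrix_inv_posdef:
  fixes A :: "real^'n^'n"
  assumes pd: "\<And>x. x \<noteq> 0 \<Longrightarrow> 0 < x \<bullet> (A *v x)" and "x \<noteq> 0"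
  shows "0 < x \<bullet> (matrix_inv A *v x)"
proof -
  have inv: "invertible A" by (rule posdef_invertible[OF pd])
  define y where "y = matrix_inv A *v x"
  have x: "x = A *v y" by (simp add: y_def matrix_inv_cancel[OF inv])
  then have "y \<noteq> 0" using \<open>x \<noteq> 0\<close> by auto
  from pd[OF this] show ?thesis by (metis x y_def inner_commute)
qed

text \<open>For a Gaussian prior with precision \<open>T\<close> and noise variance
  \<open>s\<close>, \<open>M\<close> is the posterior precision and \<open>a\<close> the posterior
  mean given \<open>y\<close>. The remainder is free of \<open>x\<close>, so it survives integration
  over \<open>x\<close>.\<close>

lemma complete_square:
  fixes T M :: "real^'n^'n" and W :: "real^'n^'m"
  assumes M: "M = T + (1 / s) *\<^sub>R (transpose W ** W)" and sym: "transpose M = M"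
    and a: "M *v a = (1 / s) *\<^sub>R (transpose W *v y)"
  shows "x \<bullet> (T *v x) + (y - W *v x) \<bullet> (y - W *v x) / s
    = (x - a) \<bullet> (M *v (x - a)) + (y \<bullet> y / s - a \<bullet> (M *v a))"
proof -
  have 1: "x \<bullet> (M *v x) = x \<bullet> (T *v x) + (W *v x) \<bullet> (W *v x) / s"
    by (simp add: M matrix_vector_mult_add_rdistrib scaleR_matrix_vector_assoc[symmetric]
        inner_add_right matrix_vector_mul_assoc[symmetric] inner_vector_matrix_mult)
  have 2: "x \<bullet> (M *v a) = (W *v x) \<bullet> y / s"
    by (simp add: a inner_vector_matrix_mult)
  have 3: "a \<bullet> (M *v x) = x \<bullet> (M *v a)"
    by (simp add: matrix_vector_inner_transpose[of a M] sym inner_commute)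
  show ?thesis
    using 1 2 3 by (simp add: matrix_vector_mult_diff_distrib inner_diff_left inner_diff_right
        inner_commute diff_divide_distrib add_divide_distrib)
qed

subsection \<open>Mutual information of a linear Gaussian channel\<close>

text \<open>The argument of the logarithm is a ratio of volumes: the determinant of the prior
  covariance \<open>Sx\<close> over that of the posterior covariance, whose inverse is the sum on
  the right. The offset \<open>b\<close> only translates \<open>z\<close>.\<close>

lemma mutual_information_gaussian_channel:
  fixes Sx :: "real^'n^'n" and W :: "real^'n^'m" and b :: "real^'m"
  assumes sym: "transpose Sx = Sx" and pd: "\<And>v. v \<noteq> 0 \<Longrightarrow> 0 < v \<bullet> (Sx *v v)" and s: "s > 0"
  shows "MI_Wb Sx s W b = ln (det Sx * det (matrix_inv Sx + (1 / s) *\<^sub>R (transpose W ** W))) / 2"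
proof -
  define T where "T = matrix_inv Sx"
  define M where "M = T + (1 / s) *\<^sub>R (transpose W ** W)"
  define N :: "real^'m^'m" where "N = (1 / s) *\<^sub>R mat 1"
  have invS: "invertible Sx" by (rule posdef_invertible[OF pd])
  have symT: "transpose T = T" unfolding T_def by (rule matrix_inv_symmetric[OF sym invS])
  have pdT: "0 < x \<bullet> (T *v x)" if "x \<noteq> 0" for x
    unfolding T_def by (rule matrix_inv_posdef[OF pd that])
  have symM: "transpose M = M"
  proof -
    have "transpose (T + (1 / s) *\<^sub>R (transpose W ** W))
        = transpose T + (1 / s) *\<^sub>R transpose (transpose W ** W)"
      by (simp add: transpose_def vec_eq_iff)
    then show ?thesis by (simp add: M_def symT matrix_transpose_mul)
  qed
  have pdM: "0 < x \<bullet> (M *v x)" if "x \<noteq> 0" for x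
  proof -
    have "x \<bullet> (M *v x) = x \<bullet> (T *v x) + (W *v x) \<bullet> (W *v x) / s"
      by (simp add: M_def matrix_vector_mult_add_rdistrib scaleR_matrix_vector_assoc[symmetric]
        inner_add_right matrix_vector_mul_assoc[symmetric] inner_vector_matrix_mult)
    then show ?thesis using pdT[OF that] s by (simp add: add_pos_nonneg)
  qed
  have invM: "invertible M" by (rule posdef_invertible[OF pdM])
  have Nv: "N *v x = (1 / s) *\<^sub>R x" for x
    by (simp add: N_def scaleR_matrix_vector_assoc[symmetric])
  have symN: "transpose N = N" by (simp add: N_def transpose_def mat_def vec_eq_iff)
  have pdN: "0 < x \<bullet> (N *v x)" if "x \<noteq> 0" for x using that s by (simp add: Nv)
  have detN: "det N = 1 / s ^ CARD('m)"
    by (subst det_diagonal) (auto simp: N_def mat_def power_one_over)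
  have det_noise: "det (s *\<^sub>R (mat 1 :: real^'m^'m)) = s ^ CARD('m)"
    by (subst det_diagonal) (auto simp: mat_def)
  have inv_noise: "matrix_inv (s *\<^sub>R (mat 1 :: real^'m^'m)) = N"
    using s by (intro matrix_inv_unique) (simp add: N_def matrix_scalar_ac)
  have "det (Sx ** T) = 1" by (simp add: T_def matrix_inv_right[OF invS])
  then have "det Sx * det T = 1" by (simp add: det_mul)
  moreover have detM: "det M > 0" and detT: "det T > 0"
    by (rule gaussian_integral(3)[OF symM pdM], simp, rule gaussian_integral(3)[OF symT pdT], simp)
  moreover have detS: "det Sx > 0" by (rule gaussian_integral(3)[OF sym pd])
  ultimately have detST: "det T = 1 / det Sx" by (simp add: field_simps)

  define cS where "cS = sqrt ((2 * pi) ^ CARD('n) * det Sx)"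
  define cN where "cN = sqrt ((2 * pi) ^ CARD('m) * s ^ CARD('m))"
  define cM where "cM = sqrt ((2 * pi) ^ CARD('n) / det M)"
  have c: "cS > 0" "cN > 0" "cM > 0" using detS s detM by (simp_all add: cS_def cN_def cM_def)
  define q where "q x = x \<bullet> (T *v x)" for x
  define a where "a z = matrix_inv M *v ((1 / s) *\<^sub>R (transpose W *v (z - b)))" for z
  define m where "m x z = (x - a z) \<bullet> (M *v (x - a z))" for x z
  define r where "r z = (z - b) \<bullet> (z - b) / s - a z \<bullet> (M *v a z)" for z
  define f where "f x = exp (- q x / 2) / cS" for x
  define g where "g x z = exp (- ((z - (W *v x + b)) \<bullet> (N *v (z - (W *v x + b)))) / 2) / cN" for x z
  \<comment> \<open>The density of \<open>z\<close>: integrating \<open>exp (- m x z / 2)\<close>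
    over \<open>x\<close> gives \<open>cM\<close> whatever the centre \<open>a z\<close> is.\<close>
  define p where "p z = exp (- r z / 2) * cM / (cS * cN)" for z
  define h where "h = (\<lambda>(x, z). f x * g x z)"
  define L where "L = ln (det Sx * det M) / 2"

  have square: "q x + (z - (W *v x + b)) \<bullet> (N *v (z - (W *v x + b))) = m x z + r z" for x z
  proof -
    have "M *v a z = (1 / s) *\<^sub>R (transpose W *v (z - b))"
      by (simp add: a_def matrix_inv_cancel(1)[OF invM] del: scaleR_right_diff_distrib)
    from complete_square[OF M_def symM this, of x]
    show ?thesis by (simp add: q_def m_def r_def Nv diff_diff_add add.commute)
  qed
  have h_alt: "h (x, z) = exp (- m x z / 2) * (exp (- r z / 2) / (cS * cN))" for x z
  proof -
    have "h (x, z) = exp (- (q x + (z - (W *v x + b)) \<bullet> (N *v (z - (W *v x + b)))) / 2) / (cS * cN)"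
      by (simp add: h_def f_def g_def exp_add[symmetric] add_divide_distrib)
    then show ?thesis unfolding square by (simp add: exp_add[symmetric] add_divide_distrib)
  qed
  have pos: "f x > 0" "g x z > 0" "p z > 0" for x z using c by (simp_all add: f_def g_def p_def)
  have h0: "h x \<ge> 0" for x using pos by (cases x) (simp add: h_def less_imp_le)
  have q0: "q x \<ge> 0" for x using pdT[of x] by (cases "x = 0") (auto simp: q_def)
  have m0: "m x z \<ge> 0" for x z using pdM[of "x - a z"] by (cases "x = a z") (auto simp: m_def)

  have lin: "continuous_on UNIV (\<lambda>x. A *v k x)" if "continuous_on UNIV k"
    for A :: "real^'k^'l" and k :: "'c::topological_space \<Rightarrow> real^'k"
    using continuous_on_compose2[OF matrix_vector_mult_linear_continuous_on[of UNIV A] that] by simp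
  have conta: "continuous_on UNIV a" unfolding a_def by (intro lin continuous_intros)
  have [measurable]: "(\<lambda>x. m (fst x) (snd x)) \<in> borel_measurable (lborel \<Otimes>\<^sub>M lborel)"
    unfolding m_def lborel_prod measurable_lborel2
    by (intro borel_measurable_continuous_onI continuous_intros lin continuous_on_compose2[OF conta]) auto
  have [measurable]: "r \<in> borel_measurable borel"
    unfolding r_def
    by (intro borel_measurable_continuous_onI continuous_intros lin conta) (use s in auto)
  have [measurable]: "q \<in> borel_measurable borel"
    unfolding q_def by (intro borel_measurable_continuous_onI continuous_intros lin)
  have [measurable]: "f \<in> borel_measurable borel" "p \<in> borel_measurable borel"
    unfolding f_def p_def by measurable
  have [measurable]: "h \<in> borel_measurable (lborel \<Otimes>\<^sub>M lborel)"
  proof -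
    have "h = (\<lambda>x. exp (- m (fst x) (snd x) / 2) * (exp (- r (snd x) / 2) / (cS * cN)))"
      using h_alt by auto
    then show ?thesis by simp
  qed

  have pdf_x: "gauss_pdf Sx 0 x = f x" for x
    by (simp add: gauss_pdf_def f_def q_def T_def cS_def)
  have pdf_z: "gauss_pdf (s *\<^sub>R mat 1) (W *v x + b) z = g x z" for x z
    by (simp add: gauss_pdf_def g_def inv_noise det_noise cN_def)
  define J where "J = joint_law Sx s W b"
  have J: "J = density (lborel \<Otimes>\<^sub>M lborel) (\<lambda>x. ennreal (h x))"
    unfolding J_def joint_law_def by (simp add: pdf_x pdf_z h_def split_beta')

  have int_const: "(\<integral>\<^sup>+x. ennreal (k x * d) \<partial>lborel) = (\<integral>\<^sup>+x. ennreal (k x) \<partial>lborel) * ennreal d"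
    if "d \<ge> 0" "\<And>x. k x \<ge> 0" and [measurable]: "k \<in> borel_measurable borel"
    for k :: "'c::euclidean_space \<Rightarrow> real" and d
    using that by (simp add: ennreal_mult nn_integral_multc)
  have int_g: "(\<integral>\<^sup>+z. ennreal (g x z) \<partial>lborel) = 1" for x
  proof -
    have "(\<integral>\<^sup>+z. ennreal (g x z) \<partial>lborel) = ennreal (sqrt ((2 * pi) ^ CARD('m) / det N)) * ennreal (1 / cN)"
    proof -
      have G: "(\<integral>\<^sup>+z. ennreal (exp (- ((z - (W *v x + b)) \<bullet> (N *v (z - (W *v x + b)))) / 2)) \<partial>lborel)
          = ennreal (sqrt ((2 * pi) ^ CARD('m) / det N))"
        by (rule gaussian_integral(1)[OF symN pdN])
      have "g x z = exp (- ((z - (W *v x + b)) \<bullet> (N *v (z - (W *v x + b)))) / 2) * (1 / cN)" for z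
        by (simp add: g_def)
      moreover have "(\<lambda>z. exp (- ((z - (W *v x + b)) \<bullet> (N *v (z - (W *v x + b)))) / 2)) \<in> borel_measurable borel"
        by (intro borel_measurable_continuous_onI continuous_intros lin) auto
      ultimately show ?thesis
        using int_const[of "1 / cN" "\<lambda>z. exp (- ((z - (W *v x + b)) \<bullet> (N *v (z - (W *v x + b)))) / 2)"] c
        by (simp only: G exp_ge_zero zero_le_divide_1_iff less_imp_le)
    qed
    also have "\<dots> = 1" using c s by (simp add: ennreal_mult[symmetric] cN_def detN)
    finally show ?thesis .
  qed
  have int_h_z: "(\<integral>\<^sup>+z. ennreal (h (x, z)) \<partial>lborel) = ennreal (f x)" for x
  proof -
    have [measurable]: "g x \<in> borel_measurable borel"
      unfolding g_def using c by (intro borel_measurable_continuous_onI continuous_intros lin) auto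
    have "(\<integral>\<^sup>+z. ennreal (h (x, z)) \<partial>lborel) = (\<integral>\<^sup>+z. ennreal (g x z) \<partial>lborel) * ennreal (f x)"
      unfolding h_def prod.case mult.commute[of "f x"]
      by (rule int_const) (auto simp: pos less_imp_le)
    then show ?thesis by (simp add: int_g)
  qed
  \<comment> \<open>For fixed \<open>z\<close>, \<open>m\<close> is a quadratic form with matrix
    \<open>M\<close> centred at \<open>a z\<close>, so both integrals are instances of
    \<open>gaussian_integral\<close>.\<close>
  have int_h_x: "(\<integral>\<^sup>+x. ennreal (h (x, z)) \<partial>lborel) = ennreal (p z)"
    and int_hm_x: "(\<integral>\<^sup>+x. ennreal (h (x, z) * m x z) \<partial>lborel) = ennreal (CARD('n) * p z)" for z
  proof -
    have meas: "(\<lambda>x. m x z) \<in> borel_measurable borel"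
      unfolding m_def by (intro borel_measurable_continuous_onI continuous_intros lin)
    note [measurable] = meas
    have "(\<integral>\<^sup>+x. ennreal (h (x, z)) \<partial>lborel)
        = (\<integral>\<^sup>+x. ennreal (exp (- m x z / 2)) \<partial>lborel) * ennreal (exp (- r z / 2) / (cS * cN))"
      unfolding h_alt by (rule int_const) (use c in auto)
    also have "(\<integral>\<^sup>+x. ennreal (exp (- m x z / 2)) \<partial>lborel) = ennreal cM"
      unfolding m_def cM_def by (rule gaussian_integral(1)[OF symM pdM])
    also have "\<dots> * ennreal (exp (- r z / 2) / (cS * cN)) = ennreal (p z)"
      using c by (simp add: ennreal_mult[symmetric] p_def mult.commute)
    finally show "(\<integral>\<^sup>+x. ennreal (h (x, z)) \<partial>lborel) = ennreal (p z)" .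
    have "(\<integral>\<^sup>+x. ennreal (h (x, z) * m x z) \<partial>lborel)
        = (\<integral>\<^sup>+x. ennreal (m x z * exp (- m x z / 2) * (exp (- r z / 2) / (cS * cN))) \<partial>lborel)"
      unfolding h_alt by (simp add: mult_ac)
    also have "\<dots> = (\<integral>\<^sup>+x. ennreal (m x z * exp (- m x z / 2)) \<partial>lborel) * ennreal (exp (- r z / 2) / (cS * cN))"
      by (rule int_const) (use c m0 in auto)
    also have "(\<integral>\<^sup>+x. ennreal (m x z * exp (- m x z / 2)) \<partial>lborel) = ennreal (CARD('n) * cM)"
      unfolding m_def cM_def by (rule gaussian_integral(2)[OF symM pdM])
    also have "\<dots> * ennreal (exp (- r z / 2) / (cS * cN)) = ennreal (CARD('n) * p z)"
      using c by (simp add: ennreal_mult[symmetric] p_def mult_ac)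
    finally show "(\<integral>\<^sup>+x. ennreal (h (x, z) * m x z) \<partial>lborel) = ennreal (CARD('n) * p z)" .
  qed
  have cS_T: "sqrt ((2 * pi) ^ CARD('n) / det T) = cS" by (simp add: detST cS_def)
  have int_f: "(\<integral>\<^sup>+x. ennreal (f x) \<partial>lborel) = 1"
  proof -
    have "(\<integral>\<^sup>+x. ennreal (f x) \<partial>lborel) = (\<integral>\<^sup>+x. ennreal (exp (- q x / 2)) \<partial>lborel) * ennreal (1 / cS)"
      using int_const[of "1 / cS" "\<lambda>x. exp (- q x / 2)"] c by (simp add: f_def)
    also have "(\<integral>\<^sup>+x. ennreal (exp (- q x / 2)) \<partial>lborel) = ennreal cS"
      unfolding q_def cS_T[symmetric] using gaussian_integral(1)[OF symT pdT, of 0] by simp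
    finally show ?thesis using c by (simp add: ennreal_mult[symmetric])
  qed
  have int_fq: "(\<integral>\<^sup>+x. ennreal (f x * q x) \<partial>lborel) = CARD('n)"
  proof -
    have "(\<integral>\<^sup>+x. ennreal (f x * q x) \<partial>lborel) = (\<integral>\<^sup>+x. ennreal (q x * exp (- q x / 2) * (1 / cS)) \<partial>lborel)"
      by (simp add: f_def mult_ac)
    also have "\<dots> = (\<integral>\<^sup>+x. ennreal (q x * exp (- q x / 2)) \<partial>lborel) * ennreal (1 / cS)"
      by (rule int_const) (use c q0 in auto)
    also have "(\<integral>\<^sup>+x. ennreal (q x * exp (- q x / 2)) \<partial>lborel) = ennreal (CARD('n) * cS)"
      unfolding q_def cS_T[symmetric] using gaussian_integral(2)[OF symT pdT, of 0] by simp
    finally show ?thesis using c by (simp add: ennreal_mult[symmetric] ennreal_of_nat_eq_real_of_nat)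
  qed
  have int_h: "(\<integral>\<^sup>+x. ennreal (h x) \<partial>(lborel \<Otimes>\<^sub>M lborel)) = 1"
    by (subst lborel.nn_integral_fst[symmetric]) (simp_all add: int_h_z int_f)
  have int_p: "(\<integral>\<^sup>+z. ennreal (p z) \<partial>lborel) = 1"
    using lborel_pair.nn_integral_snd[of "\<lambda>x. ennreal (h x)"] by (simp add: int_h_x int_h)
  \<comment> \<open>Since \<open>q\<close> depends on \<open>x\<close> alone, \<open>z\<close> is
    integrated out first; for \<open>m\<close>, whose centre depends on \<open>z\<close>, the order
    is reversed.\<close>
  have int_hq: "(\<integral>\<^sup>+x. ennreal (h x * q (fst x)) \<partial>(lborel \<Otimes>\<^sub>M lborel)) = CARD('n)"
  proof -
    have "(\<integral>\<^sup>+z. ennreal (h (x, z) * q x) \<partial>lborel) = ennreal (f x * q x)" for x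
    proof -
      have [measurable]: "(\<lambda>z. h (x, z)) \<in> borel_measurable borel"
        unfolding h_def g_def prod.case using c by (intro borel_measurable_continuous_onI continuous_intros lin) auto
      have "(\<integral>\<^sup>+z. ennreal (h (x, z) * q x) \<partial>lborel) = (\<integral>\<^sup>+z. ennreal (h (x, z)) \<partial>lborel) * ennreal (q x)"
        by (rule int_const) (auto simp: q0 h0)
      then show ?thesis by (simp add: int_h_z ennreal_mult[symmetric] q0 pos less_imp_le)
    qed
    then show ?thesis
      by (subst lborel.nn_integral_fst[symmetric]) (simp_all add: int_fq)
  qed
  have int_hm: "(\<integral>\<^sup>+x. ennreal (h x * m (fst x) (snd x)) \<partial>(lborel \<Otimes>\<^sub>M lborel)) = CARD('n)"
    by (subst lborel_pair.nn_integral_snd[symmetric])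
       (simp_all add: int_hm_x ennreal_mult nn_integral_cmult int_p pos less_imp_le ennreal_of_nat_eq_real_of_nat)

  \<comment> \<open>Nonnegativity and finite values give integrability, which permits subtracting
    the two expectations later.\<close>
  have bochner: "has_bochner_integral (lborel \<Otimes>\<^sub>M lborel) h 1"
    "has_bochner_integral (lborel \<Otimes>\<^sub>M lborel) (\<lambda>x. h x * q (fst x)) (CARD('n))"
    "has_bochner_integral (lborel \<Otimes>\<^sub>M lborel) (\<lambda>x. h x * m (fst x) (snd x)) (CARD('n))"
    using int_h int_hq int_hm h0 q0 m0
    by (auto intro!: has_bochner_integral_nn_integral simp: ennreal_of_nat_eq_real_of_nat)

  interpret prob_space J
  proof
    have "emeasure J (space J) = (\<integral>\<^sup>+x. ennreal (h x) * indicator (space (lborel \<Otimes>\<^sub>M lborel)) x \<partial>(lborel \<Otimes>\<^sub>M lborel))"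
      unfolding J space_density by (rule emeasure_density) (simp_all only: sets.top, measurable)
    also have "\<dots> = (\<integral>\<^sup>+x. ennreal (h x) \<partial>(lborel \<Otimes>\<^sub>M lborel))"
      by (rule nn_integral_cong) (simp del: space_pair_measure)
    finally show "emeasure J (space J) = 1" by (simp add: int_h)
  qed
  interpret information_space J "exp 1" by standard simp
  have distJ: "distributed J (lborel \<Otimes>\<^sub>M lborel) (\<lambda>x. (fst x, snd x)) (\<lambda>x. ennreal (h x))"
    unfolding distributed_def J by (simp add: distr_id2)
  have dX: "distributed J lborel fst (\<lambda>x. ennreal (f x))"
    using distr_marginal1[OF lborel.sigma_finite_measure_axioms lborel.sigma_finite_measure_axioms distJ]
    by (simp add: int_h_z)
  have dZ: "distributed J lborel snd (\<lambda>z. ennreal (p z))"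
    using distr_marginal2[OF lborel.sigma_finite_measure_axioms lborel.sigma_finite_measure_axioms distJ]
    by (simp add: int_h_x)
  \<comment> \<open>The factor \<open>exp (- r z / 2)\<close> occurs in both \<open>h\<close> and
    \<open>p\<close> and cancels; of the normalising constants only \<open>cS / cM\<close>
    remains.\<close>
  have log_ratio: "log (exp 1) (h x / (f (fst x) * p (snd x))) = L + (q (fst x) - m (fst x) (snd x)) / 2" for x
  proof -
    obtain u z where x: "x = (u, z)" by force
    have "h (u, z) / (f u * p z) = exp (- m u z / 2) * exp (q u / 2) * (cS / cM)"
      using c by (simp add: h_alt f_def p_def exp_minus field_simps)
    also have "exp (- m u z / 2) * exp (q u / 2) = exp ((q u - m u z) / 2)"
      by (simp add: exp_add[symmetric] diff_divide_distrib)
    also have "ln (\<dots> * (cS / cM)) = (q u - m u z) / 2 + ln (cS / cM)"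
      using c by (subst ln_mult) simp_all
    also have "cS / cM = sqrt (det Sx * det M)"
      using detM by (simp add: cS_def cM_def real_sqrt_divide[symmetric])
    also have "ln (sqrt (det Sx * det M)) = L" using detS detM by (simp add: L_def ln_sqrt)
    finally show ?thesis by (simp add: x log_def)
  qed
  have "MI_Wb Sx s W b = mutual_information (exp 1) lborel lborel fst snd"
    by (simp add: MI_Wb_def J_def)
  also have "\<dots> = integral\<^sup>L (lborel \<Otimes>\<^sub>M lborel) (\<lambda>x. h x * log (exp 1) (h x / (f (fst x) * p (snd x))))"
    by (rule mutual_information_distr[OF lborel.sigma_finite_measure_axioms lborel.sigma_finite_measure_axioms dX _ dZ _ distJ])
       (auto simp: pos h0 less_imp_le)
  also have "\<dots> = integral\<^sup>L (lborel \<Otimes>\<^sub>M lborel) (\<lambda>x. h x * L + (h x * q (fst x) - h x * m (fst x) (snd x)) / 2)"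
    unfolding log_ratio by (simp add: algebra_simps diff_divide_distrib)
  also have "\<dots> = 1 * L + (real CARD('n) - real CARD('n)) / 2"
    by (rule has_bochner_integral_integral_eq)
       (intro has_bochner_integral_add has_bochner_integral_mult_left has_bochner_integral_divide has_bochner_integral_diff bochner)
  finally show ?thesis by (simp add: L_def M_def T_def)
qed

subsection \<open>Water filling\<close>

definition max_rate :: "(nat \<Rightarrow> real) \<Rightarrow> real \<Rightarrow> real \<Rightarrow> nat \<Rightarrow> real" where
  "max_rate lam s F n = real n / 2 * ln ((F + s * tr_inv_Sigma_k lam n) / (s * real n))
     + 1/2 * ln (det_Sigma_k lam n)"

text \<open>Equal values at all reals make the polynomials equal, hence also their multisets of
  roots. Multisets are essential because eigenvalues may repeat.\<close>

lemma prod_linear_factors_eq_imp_bij: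
  fixes f :: "'a \<Rightarrow> real" and g :: "'b \<Rightarrow> real"
  assumes A: "finite A" and B: "finite B"
    and eq: "\<And>t. (\<Prod>a\<in>A. t - f a) = (\<Prod>b\<in>B. t - g b)"
  obtains \<pi> where "bij_betw \<pi> A B" "\<And>a. a \<in> A \<Longrightarrow> f a = g (\<pi> a)"
proof -
  have "poly (\<Prod>a\<in>A. [:- f a, 1:]) t = poly (\<Prod>b\<in>B. [:- g b, 1:]) t" for t
    using eq[of t] by (simp add: poly_prod)
  then have polys: "(\<Prod>a\<in>A. [:- f a, 1:]) = (\<Prod>b\<in>B. [:- g b, 1:])"
    by (simp add: poly_eq_poly_eq_iff[symmetric] fun_eq_iff)
  have proots: "proots (\<Prod>a\<in>S. [:- h a, 1:]) = image_mset h (mset_set S)"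
    if "finite S" for S :: "'c set" and h :: "'c \<Rightarrow> real"
  proof -
    have "proots (\<Prod>a\<in>S. [:- h a, 1:]) = (\<Sum>a\<in>S. {#h a#})"
      by (subst proots_prod) auto
    also have "\<dots> = image_mset h (mset_set S)"
      using that by (induction S rule: finite_induct) auto
    finally show ?thesis .
  qed
  have ms: "image_mset f (mset_set A) = image_mset g (mset_set B)"
    using proots[OF A, of f] proots[OF B, of g] polys by simp
  then have "card A = card B" by (metis size_image_mset size_mset_set)
  \<comment> \<open>The permutation result compares two functions on one set, so \<open>B\<close> is
    first identified with \<open>A\<close> by an arbitrary bijection.\<close>
  then obtain \<tau> where \<tau>: "bij_betw \<tau> A B" using finite_same_card_bij[OF A B] by blast
  have "image_mset g (mset_set B) = image_mset (g \<circ> \<tau>) (mset_set A)"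
    using \<tau> image_mset_mset_set[of \<tau> A] by (metis bij_betw_def multiset.map_comp)
  with ms obtain p where p: "p permutes A" "\<forall>a\<in>A. f a = (g \<circ> \<tau>) (p a)"
    using image_mset_eq_implies_permutes[OF A, of f "g \<circ> \<tau>"] by auto
  have "bij_betw (\<tau> \<circ> p) A B" using permutes_imp_bij[OF p(1)] \<tau> by (rule bij_betw_trans)
  moreover have "f a = g ((\<tau> \<circ> p) a)" if "a \<in> A" for a using p that by simp
  ultimately show ?thesis by (rule that)
qed

text \<open>The characteristic polynomial computed in an eigenbasis is compared with the given
  factorisation; \<open>idx i\<close> is the position in \<open>lam\<close> assigned to
  \<open>e i\<close>.\<close>

lemma eigenbasis_enumeration:
  fixes A :: "real^'n^'n" and lam :: "nat \<Rightarrow> real"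
  assumes sym: "transpose A = A"
    and eig: "\<And>t. det (mat t - A) = (\<Prod>i=1..CARD('n). (t - lam i))"
  obtains e :: "'n \<Rightarrow> real^'n" and idx where "orthonormal_family e"
    "bij_betw idx UNIV {1..CARD('n)}" "\<And>i. A *v e i = lam (idx i) *\<^sub>R e i"
proof -
  obtain e d where e: "orthonormal_family e" and ed: "\<And>i. A *v e i = d i *\<^sub>R e i"
    using symmetric_matrix_eigenbasis[OF sym] by blast
  have "det (mat t - A) = (\<Prod>i\<in>UNIV. t - d i)" for t
  proof (rule det_eigenbasis[OF e])
    fix i
    have "mat t = t *\<^sub>R (mat 1 :: real^'n^'n)" by (simp add: mat_def vec_eq_iff)
    then have "mat t *v e i = t *\<^sub>R e i"
      by (simp add: scaleR_matrix_vector_assoc[symmetric])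
    then show "(mat t - A) *v e i = (t - d i) *\<^sub>R e i"
      by (simp add: matrix_vector_mult_diff_rdistrib ed scaleR_diff_left)
  qed
  then have "(\<Prod>i\<in>UNIV. t - d i) = (\<Prod>i\<in>{1..CARD('n)}. t - lam i)" for t
    using eig by simp
  then obtain idx where "bij_betw idx UNIV {1..CARD('n)}" "\<And>i. d i = lam (idx i)"
    using prod_linear_factors_eq_imp_bij[of UNIV "{1..CARD('n)}" d lam] by auto
  then show ?thesis using that[OF e] ed by auto
qed

section \<open>Optimality and attainment of the water-filling value\<close>

context
  fixes Sx :: "real^'n0^'n0" and lam :: "nat \<Rightarrow> real" and s F :: real and n :: nat
    and e :: "'n0 \<Rightarrow> real^'n0" and idx :: "'n0 \<Rightarrow> nat"
  assumes sym: "transpose Sx = Sx" and pd: "\<And>v. v \<noteq> 0 \<Longrightarrow> 0 < v \<bullet> (Sx *v v)"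
    and e: "orthonormal_family e" and idx: "bij_betw idx UNIV {1..CARD('n0)}"
    and eig: "\<And>i. Sx *v e i = lam (idx i) *\<^sub>R e i"
    and sorted: "\<And>i j. 1 \<le> i \<Longrightarrow> i \<le> j \<Longrightarrow> j \<le> CARD('n0) \<Longrightarrow> lam j \<le> lam i"
    and lam_pos: "lam (CARD('n0)) > 0"
    and s: "s > 0" and n: "1 \<le> n" "n < CARD('n0)"
    and F1: "rho s lam n \<le> F" and F2: "F \<le> rho s lam (n + 1)"
begin

lemma lam_idx: "idx i \<in> {1..CARD('n0)}"
  using idx by (auto simp: bij_betw_def)

lemma lam_gt_0: "1 \<le> j \<Longrightarrow> j \<le> CARD('n0) \<Longrightarrow> 0 < lam j"
  using sorted[of j "CARD('n0)"] lam_pos by linarith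

lemma e_inner: "e i \<bullet> e j = (if i = j then 1 else 0)"
  using e by (simp add: orthonormal_family_def)

lemma sum_idx: "(\<Sum>i\<in>UNIV. h (idx i)) = (\<Sum>j=1..CARD('n0). h j :: real)"
  using sum.reindex_bij_betw[OF idx] .

lemma prod_idx: "(\<Prod>i\<in>UNIV. h (idx i)) = (\<Prod>j=1..CARD('n0). h j :: real)"
  using prod.reindex_bij_betw[OF idx] .

lemma split_range: "{1..CARD('n0)} = {1..n} \<union> {n+1..CARD('n0)}" "{1..n} \<inter> {n+1..CARD('n0)} = {}"
  using n by auto

text \<open>The water level, i.e. the common value of \<open>s / lam j + w j\<close> over the \<open>n\<close> active eigendirections,
  where \<open>w j\<close> is the gain allotted to the \<open>j\<close>-th one.\<close>
definition level :: real where "level = (F + s * tr_inv_Sigma_k lam n) / n"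

text \<open>Solved for \<open>level\<close>, the conditions on \<open>F\<close> are the cases
  \<open>j = n\<close> and \<open>j = n + 1\<close>; the ordering of \<open>lam\<close> extends them
  to all other directions.\<close>

lemma level_bounds:
  shows "1 \<le> j \<Longrightarrow> j \<le> n \<Longrightarrow> s / lam j \<le> level"
    and "n < j \<Longrightarrow> j \<le> CARD('n0) \<Longrightarrow> level \<le> s / lam j"
    and "level > 0"
proof -
  have "s * (n / lam n) \<le> F + s * tr_inv_Sigma_k lam n"
    using F1 by (simp add: rho_def tr_inv_Sigma_k_def algebra_simps)
  then have low: "s / lam n \<le> level" using n by (simp add: level_def field_simps)
  then show "s / lam j \<le> level" if "1 \<le> j" "j \<le> n" for j
  proof -
    have "s / lam j \<le> s / lam n"
      using that n s lam_gt_0[of n] lam_gt_0[of j] sorted[of j n] by (intro divide_left_mono) auto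
    with low show ?thesis by simp
  qed
  show "level > 0" using low lam_gt_0[of n] n s by (smt (verit) divide_pos_pos less_imp_le)
  \<comment> \<open>The last summand of \<open>rho s lam (n + 1)\<close> cancels one of the
    \<open>n + 1\<close> copies of \<open>1 / lam (n + 1)\<close>, so this condition concerns the
    same \<open>level\<close>.\<close>
  have "F \<le> s * ((real n + 1) / lam (n + 1) - (tr_inv_Sigma_k lam n + 1 / lam (n + 1)))"
    using F2 by (simp add: rho_def tr_inv_Sigma_k_def add.commute)
  also have "\<dots> = s * (n / lam (n + 1) - tr_inv_Sigma_k lam n)" by (simp add: add_divide_distrib)
  finally have "level \<le> s / lam (n + 1)" using n by (simp add: level_def field_simps)
  then show "level \<le> s / lam j" if "n < j" "j \<le> CARD('n0)" for j
  proof -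
    have "s / lam (n + 1) \<le> s / lam j"
      using that n s lam_gt_0[of "n + 1"] lam_gt_0[of j] sorted[of "n + 1" j]
      by (intro divide_left_mono) auto
    with \<open>level \<le> s / lam (n + 1)\<close> show ?thesis by simp
  qed
qed

definition optimal_diag :: "nat \<Rightarrow> real" where
  "optimal_diag j = (if j \<le> n then level / s else 1 / lam j)"

lemma optimal_diag_bounds:
  assumes "1 \<le> j" "j \<le> CARD('n0)"
  shows "0 < optimal_diag j" "level / s \<le> optimal_diag j"
proof -
  show "level / s \<le> optimal_diag j"
    using level_bounds(2)[of j] assms s by (auto simp: optimal_diag_def field_simps)
  then show "0 < optimal_diag j" using level_bounds(3) s by (smt (verit) divide_pos_pos)
qed

lemma ln_optimal_diag:
  "ln ((\<Prod>j=1..CARD('n0). lam j) * (\<Prod>j=1..CARD('n0). optimal_diag j)) / 2 = max_rate lam s F n"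
proof -
  have "(\<Prod>j=1..CARD('n0). lam j) * (\<Prod>j=1..CARD('n0). optimal_diag j)
      = (\<Prod>j=1..CARD('n0). lam j * optimal_diag j)" by (simp add: prod.distrib)
  also have "\<dots> = (\<Prod>j=1..n. lam j * optimal_diag j) * (\<Prod>j=n+1..CARD('n0). lam j * optimal_diag j)"
    unfolding split_range(1) by (rule prod.union_disjoint) (use split_range(2) in auto)
  also have "(\<Prod>j=n+1..CARD('n0). lam j * optimal_diag j) = 1"
  proof (rule prod.neutral, rule ballI)
    fix j assume "j \<in> {n+1..CARD('n0)}"
    then show "lam j * optimal_diag j = 1"
      using lam_gt_0[of j] by (auto simp: optimal_diag_def)
  qed
  also have "(\<Prod>j=1..n. lam j * optimal_diag j) = det_Sigma_k lam n * (level / s) ^ n"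
    unfolding prod.distrib by (simp add: optimal_diag_def det_Sigma_k_def)
  finally have eq: "(\<Prod>j=1..CARD('n0). lam j) * (\<Prod>j=1..CARD('n0). optimal_diag j)
      = det_Sigma_k lam n * (level / s) ^ n" by simp
  have "det_Sigma_k lam n > 0"
    unfolding det_Sigma_k_def using n by (intro prod_pos) (auto intro: lam_gt_0)
  moreover have "level / s > 0" using level_bounds(3) s by simp
  moreover have "level / s = (F + s * tr_inv_Sigma_k lam n) / (s * n)" by (simp add: level_def)
  ultimately show ?thesis
    unfolding eq max_rate_def by (simp add: ln_mult ln_realpow add_divide_distrib del: times_divide_eq_right)
qed

lemma sum_optimal_diag:
  "(\<Sum>j=1..CARD('n0). 1 / lam j / optimal_diag j) + F / level = CARD('n0)"
proof -
  have "(\<Sum>j=1..CARD('n0). 1 / lam j / optimal_diag j)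
      = (\<Sum>j=1..n. 1 / lam j / optimal_diag j) + (\<Sum>j=n+1..CARD('n0). 1 / lam j / optimal_diag j)"
    unfolding split_range(1) by (rule sum.union_disjoint) (use split_range(2) in auto)
  also have "(\<Sum>j=n+1..CARD('n0). 1 / lam j / optimal_diag j) = (\<Sum>j=n+1..CARD('n0). 1)"
  proof (rule sum.cong[OF refl])
    fix j assume "j \<in> {n+1..CARD('n0)}"
    then show "1 / lam j / optimal_diag j = 1"
      using lam_gt_0[of j] by (auto simp: optimal_diag_def)
  qed
  also have "(\<Sum>j=1..n. 1 / lam j / optimal_diag j) = s * tr_inv_Sigma_k lam n / level"
    by (simp add: optimal_diag_def tr_inv_Sigma_k_def sum_divide_distrib sum_distrib_left)
  finally have "(\<Sum>j=1..CARD('n0). 1 / lam j / optimal_diag j) + F / level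
      = (F + s * tr_inv_Sigma_k lam n) / level + (real (CARD('n0)) - n)"
    using n by (simp add: add_divide_distrib of_nat_diff)
  also have "F + s * tr_inv_Sigma_k lam n = n * level" using n by (simp add: level_def)
  finally show ?thesis using level_bounds(3) by simp
qed

lemma det_Sx: "det Sx = (\<Prod>j=1..CARD('n0). lam j)"
  using det_eigenbasis[OF e eig] by (simp add: prod_idx)

lemma inv_eig: "matrix_inv Sx *v e i = (1 / lam (idx i)) *\<^sub>R e i"
proof -
  have "Sx *v ((1 / lam (idx i)) *\<^sub>R e i) = e i"
    using lam_gt_0[of "idx i"] lam_idx[of i]
    by (simp add: linear_scale[OF matrix_vector_mul_linear] eig)
  then show ?thesis using matrix_inv_cancel(2)[OF posdef_invertible[OF pd]] by metis
qed

lemma rate_upper_bound: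
  fixes W :: "real^'n0^'n1"
  assumes tr: "trace (transpose W ** W) \<le> F"
  shows "ln (det Sx * det (matrix_inv Sx + (1 / s) *\<^sub>R (transpose W ** W))) / 2 \<le> max_rate lam s F n"
proof -
  define M where "M = matrix_inv Sx + (1 / s) *\<^sub>R (transpose W ** W)"
  have invS: "invertible Sx" by (rule posdef_invertible[OF pd])
  have symM: "transpose M = M"
  proof -
    have "transpose M = transpose (matrix_inv Sx) + (1 / s) *\<^sub>R transpose (transpose W ** W)"
      by (simp add: M_def transpose_def vec_eq_iff)
    then show ?thesis by (simp add: M_def matrix_inv_symmetric[OF sym invS] matrix_transpose_mul)
  qed
  have quad: "x \<bullet> (M *v y) = x \<bullet> (matrix_inv Sx *v y) + (W *v x) \<bullet> (W *v y) / s" for x y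
    by (simp add: M_def matrix_vector_mult_add_rdistrib scaleR_matrix_vector_assoc[symmetric]
        inner_add_right matrix_vector_mul_assoc[symmetric] inner_vector_matrix_mult)
  have pdM: "0 < x \<bullet> (M *v x)" if "x \<noteq> 0" for x
    using matrix_inv_posdef[OF pd that] s by (simp add: quad add_pos_nonneg)
  have psdM: "0 \<le> x \<bullet> (M *v x)" for x using pdM[of x] by (cases "x = 0") auto
  \<comment> \<open>The same operator in the eigenbasis of \<open>Sx\<close>, where the tangent
    point is diagonal; the determinant is unchanged.\<close>
  define B :: "real^'n0^'n0" where "B = (\<chi> i j. e i \<bullet> (M *v e j))"
  have detB: "det B = det M" unfolding B_def by (rule det_in_orthonormal_basis[OF e])
  have B_alt: "B = (\<chi> i. e i) ** M ** transpose (\<chi> i. e i)"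
    unfolding B_def by (rule conjugate_entries[symmetric])
  have symB: "transpose B = B"
    by (simp add: B_alt matrix_transpose_mul symM matrix_mul_assoc)
  have psdB: "0 \<le> x \<bullet> (B *v x)" for x
  proof -
    have "x \<bullet> (B *v x) = x \<bullet> ((\<chi> i. e i) *v (M *v (transpose (\<chi> i. e i) *v x)))"
      by (simp only: B_alt matrix_vector_mul_assoc matrix_mul_assoc)
    also have "\<dots> = (transpose (\<chi> i. e i) *v x) \<bullet> (M *v (transpose (\<chi> i. e i) *v x))"
      by (rule matrix_vector_inner_transpose)
    finally show ?thesis using psdM by simp
  qed
  define c where "c i = optimal_diag (idx i)" for i
  have c: "c i > 0" "level / s \<le> c i" for i
    using optimal_diag_bounds[of "idx i"] lam_idx[of i] by (auto simp: c_def)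
  \<comment> \<open>Basis independence of the trace expresses the power constraint through the
    powers spent in the eigendirections.\<close>
  have G: "(\<Sum>i\<in>UNIV. (W *v e i) \<bullet> (W *v e i)) = trace (transpose W ** W)"
    using trace_in_orthonormal_basis[OF e, of "transpose W ** W"]
    by (simp add: matrix_vector_mul_assoc[symmetric] inner_vector_matrix_mult)
  have Bii: "B $ i $ i = 1 / lam (idx i) + (W *v e i) \<bullet> (W *v e i) / s" for i
    by (simp add: B_def quad inv_eig e_inner)
  have "(\<Sum>i\<in>UNIV. B $ i $ i / c i)
      \<le> (\<Sum>i\<in>UNIV. 1 / lam (idx i) / c i + (W *v e i) \<bullet> (W *v e i) / level)"
  proof (rule sum_mono)
    fix i
    have "(W *v e i) \<bullet> (W *v e i) / s / c i \<le> (W *v e i) \<bullet> (W *v e i) / s / (level / s)"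
      using c[of i] s level_bounds(3) by (intro divide_left_mono) auto
    then show "B $ i $ i / c i \<le> 1 / lam (idx i) / c i + (W *v e i) \<bullet> (W *v e i) / level"
      using s by (simp add: Bii add_divide_distrib)
  qed
  also have "\<dots> = (\<Sum>j=1..CARD('n0). 1 / lam j / optimal_diag j) + trace (transpose W ** W) / level"
    by (simp only: sum.distrib c_def sum_idx[of "\<lambda>j. 1 / lam j / optimal_diag j"] G sum_divide_distrib[symmetric])
  also have "\<dots> \<le> CARD('n0)"
    using divide_right_mono[OF tr, of level] level_bounds(3) sum_optimal_diag by linarith
  finally have expo: "exp ((\<Sum>i\<in>UNIV. B $ i $ i / c i) - CARD('n0)) \<le> 1" by simp
  have c_prod: "(\<Prod>i\<in>UNIV. c i) > 0" using c by (simp add: prod_pos)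
  have "det M \<le> (\<Prod>i\<in>UNIV. c i) * exp ((\<Sum>i\<in>UNIV. B $ i $ i / c i) - CARD('n0))"
    unfolding detB[symmetric] by (rule det_le_diagonal[OF symB psdB c(1)])
  also have "\<dots> \<le> (\<Prod>i\<in>UNIV. c i) * 1" using expo c_prod by (intro mult_left_mono) auto
  also have "\<dots> = (\<Prod>j=1..CARD('n0). optimal_diag j)" by (simp add: c_def prod_idx)
  finally have "det Sx * det M \<le> (\<Prod>j=1..CARD('n0). lam j) * (\<Prod>j=1..CARD('n0). optimal_diag j)"
    using gaussian_integral(3)[OF sym pd] by (simp add: det_Sx)
  moreover have "0 < det Sx * det M"
    using gaussian_integral(3)[OF sym pd] gaussian_integral(3)[OF symM pdM] by simp
  ultimately have "ln (det Sx * det M) \<le> ln ((\<Prod>j=1..CARD('n0). lam j) * (\<Prod>j=1..CARD('n0). optimal_diag j))"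
    by simp
  then show "ln (det Sx * det (matrix_inv Sx + (1 / s) *\<^sub>R (transpose W ** W))) / 2 \<le> max_rate lam s F n"
    using ln_optimal_diag by (simp add: M_def)
qed

text \<open>\<open>W\<close> sends the active eigenvectors to multiples of distinct coordinate axes
  and kills the others. The images are orthogonal, so \<open>transpose W ** W\<close> is diagonal in
  the eigenbasis; \<open>n \<le> CARD('n1)\<close> provides enough axes.\<close>

lemma rate_attained:
  assumes "n \<le> CARD('n1::finite)"
  obtains W :: "real^'n0^'n1" where "trace (transpose W ** W) = F"
    "ln (det Sx * det (matrix_inv Sx + (1 / s) *\<^sub>R (transpose W ** W))) / 2 = max_rate lam s F n"
proof -
  define I where "I = {i. idx i \<le> n}"
  have idx_inj: "inj idx" using idx by (auto simp: bij_betw_def)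
  have "card I = card (idx ` I)" by (rule card_image[symmetric]) (use idx_inj inj_on_subset in blast)
  also have "idx ` I \<subseteq> {1..n}" using lam_idx by (auto simp: I_def)
  then have "card (idx ` I) \<le> n" by (metis card_atLeastAtMost card_mono diff_Suc_1 finite_atLeastAtMost)
  finally have "card I \<le> card (UNIV :: 'n1 set)" using assms by simp
  then obtain k :: "'n0 \<Rightarrow> 'n1" where k: "inj_on k I" using card_le_inj[of I "UNIV :: 'n1 set"] by auto
  \<comment> \<open>The depth of water over direction \<open>i\<close>, nonnegative by the lower
    bound on \<open>level\<close>, so that its square root is a valid gain.\<close>
  define w where "w i = (if i \<in> I then level - s / lam (idx i) else 0)" for i
  have w0: "w i \<ge> 0" for i
    using level_bounds(1)[of "idx i"] lam_idx[of i] by (auto simp: w_def I_def)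
  \<comment> \<open>Row \<open>k i\<close> is \<open>sqrt (w i)\<close> times \<open>e i\<close>;
    rows outside the image of \<open>k\<close> on \<open>I\<close> vanish.\<close>
  define W :: "real^'n0^'n1" where
    "W = (\<chi> r c. \<Sum>i\<in>I. (if k i = r then sqrt (w i) * e i $ c else 0))"
  have W: "W *v x = (\<Sum>i\<in>I. (sqrt (w i) * (e i \<bullet> x)) *\<^sub>R axis (k i) 1)" for x
  proof -
    have "(W *v x) $ r = (\<Sum>i\<in>I. (sqrt (w i) * (e i \<bullet> x)) *\<^sub>R axis (k i) 1) $ r" for r
    proof -
      have "(W *v x) $ r = (\<Sum>c\<in>UNIV. \<Sum>i\<in>I. (if k i = r then sqrt (w i) * e i $ c else 0) * x $ c)"
        by (simp add: W_def matrix_vector_mult_def sum_distrib_right)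
      also have "\<dots> = (\<Sum>i\<in>I. \<Sum>c\<in>UNIV. (if k i = r then sqrt (w i) * e i $ c else 0) * x $ c)"
        by (rule sum.swap)
      also have "\<dots> = (\<Sum>i\<in>I. if k i = r then sqrt (w i) * (e i \<bullet> x) else 0)"
        by (intro sum.cong refl) (auto simp: inner_vec_def sum_distrib_left mult.assoc)
      also have "\<dots> = (\<Sum>i\<in>I. (sqrt (w i) * (e i \<bullet> x)) *\<^sub>R axis (k i) 1) $ r"
        by (auto simp: sum_component axis_def intro!: sum.cong)
      finally show ?thesis .
    qed
    then show ?thesis by (simp add: vec_eq_iff)
  qed
  have We: "W *v e j = (if j \<in> I then sqrt (w j) *\<^sub>R axis (k j) 1 else 0)" for j
  proof -
    have "W *v e j = (\<Sum>i\<in>I. if i = j then sqrt (w i) *\<^sub>R axis (k i) 1 else 0)"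
      unfolding W by (intro sum.cong) (auto simp: e_inner)
    then show ?thesis by (simp add: sum.delta')
  qed
  have WeWe: "(W *v e i) \<bullet> (W *v e j) = (if i = j then w i else 0)" for i j
  proof -
    have "k i \<noteq> k j" if "i \<in> I" "j \<in> I" "i \<noteq> j" using k that by (auto simp: inj_on_def)
    then show ?thesis using w0[of i] by (auto simp: We inner_axis_axis w_def)
  qed
  have quadG: "e i \<bullet> ((transpose W ** W) *v e j) = (if i = j then w i else 0)" for i j
    using WeWe[of i j] by (simp add: matrix_vector_mul_assoc[symmetric] inner_vector_matrix_mult)
  have GW: "(transpose W ** W) *v e j = w j *\<^sub>R e j" for j
  proof -
    have "(transpose W ** W) *v e j = (\<Sum>i\<in>UNIV. (e i \<bullet> ((transpose W ** W) *v e j)) *\<^sub>R e i)"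
      by (rule orthonormal_family_expand[OF e])
    also have "\<dots> = (\<Sum>i\<in>UNIV. if i = j then w j *\<^sub>R e j else 0)"
      unfolding quadG by (intro sum.cong) auto
    finally show ?thesis by simp
  qed
  show ?thesis
  proof (rule that[of W])
    have "trace (transpose W ** W) = (\<Sum>i\<in>UNIV. w i)"
      by (simp add: trace_in_orthonormal_basis[OF e, symmetric] quadG)
    also have "\<dots> = (\<Sum>i\<in>UNIV. (\<lambda>j. if j \<le> n then level - s / lam j else 0) (idx i))"
      by (simp add: w_def I_def)
    also have "\<dots> = (\<Sum>j=1..CARD('n0). if j \<le> n then level - s / lam j else 0)"
      by (rule sum_idx)
    also have "\<dots> = (\<Sum>j=1..n. level - s / lam j)"
      using n by (intro sum.mono_neutral_cong_right) auto
    \<comment> \<open>The level is the one at which the depths add up to \<open>F\<close>.\<close>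
    also have "\<dots> = F"
      using n by (simp add: sum_subtractf level_def tr_inv_Sigma_k_def sum_distrib_left)
    finally show "trace (transpose W ** W) = F" .
    have "det (matrix_inv Sx + (1 / s) *\<^sub>R (transpose W ** W)) = (\<Prod>i\<in>UNIV. optimal_diag (idx i))"
    proof (rule det_eigenbasis[OF e])
      fix i
      have "(matrix_inv Sx + (1 / s) *\<^sub>R (transpose W ** W)) *v e i = (1 / lam (idx i) + w i / s) *\<^sub>R e i"
        by (simp add: matrix_vector_mult_add_rdistrib scaleR_matrix_vector_assoc[symmetric] GW inv_eig
            scaleR_add_left)
      also have "1 / lam (idx i) + w i / s = optimal_diag (idx i)"
        using s by (simp add: w_def I_def optimal_diag_def diff_divide_distrib)
      finally show "(matrix_inv Sx + (1 / s) *\<^sub>R (transpose W ** W)) *v e i = optimal_diag (idx i) *\<^sub>R e i" .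
    qed
    then show "ln (det Sx * det (matrix_inv Sx + (1 / s) *\<^sub>R (transpose W ** W))) / 2 = max_rate lam s F n"
      by (simp only: prod_idx det_Sx ln_optimal_diag)
  qed
qed

end

section \<open>Evaluation of the supremum\<close>

theorem theorem2:
  fixes Sx :: "real^'n0^'n0" and lam :: "nat \<Rightarrow> real" and s2 F :: real and K :: nat
  assumes sym: "transpose Sx = Sx"
    and posdef: "\<And>v. v \<noteq> 0 \<Longrightarrow> v \<bullet> (Sx *v v) > 0"
    and eig: "\<And>t. det (mat t - Sx) = (\<Prod>i=1..CARD('n0). (t - lam i))"
    and sorted: "\<And>i j. 1 \<le> i \<Longrightarrow> i \<le> j \<Longrightarrow> j \<le> CARD('n0) \<Longrightarrow> lam j \<le> lam i"
    and lam_pos: "lam (CARD('n0)) > 0"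
    and s2_pos: "s2 > 0"
    and K1: "1 \<le> K" and K2: "K < min CARD('n0) CARD('n1)"
    and F1: "rho s2 lam (min CARD('n0) CARD('n1) - K) \<le> F"
    and F2: "F \<le> rho s2 lam (min CARD('n0) CARD('n1) - K + 1)"
  shows "MMI Sx s2 F TYPE('n1::finite) =
     real (min CARD('n0) CARD('n1) - K) / 2 *
       ln ((F + s2 * tr_inv_Sigma_k lam (min CARD('n0) CARD('n1) - K))
           / (s2 * real (min CARD('n0) CARD('n1) - K)))
     + 1/2 * ln (det_Sigma_k lam (min CARD('n0) CARD('n1) - K))"
proof -
  define n where "n = min CARD('n0) CARD('n1) - K"
  \<comment> \<open>\<open>1 \<le> K\<close> leaves room for an eigenvalue with index
    \<open>n + 1\<close>, to which the upper bound on \<open>F\<close> refers; \<open>K\<close>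
    below the minimum keeps \<open>n\<close> positive.\<close>
  have n: "1 \<le> n" "n < CARD('n0)" "n \<le> CARD('n1)" using K1 K2 by (auto simp: n_def)
  obtain e :: "'n0 \<Rightarrow> real^'n0" and idx where basis: "orthonormal_family e"
    "bij_betw idx UNIV {1..CARD('n0)}" "\<And>i. Sx *v e i = lam (idx i) *\<^sub>R e i"
    using eigenbasis_enumeration[OF sym eig] by blast
  note water_filling = sym posdef basis sorted lam_pos s2_pos n(1,2) F1[folded n_def] F2[folded n_def]
  obtain W :: "real^'n0^'n1" where W: "trace (transpose W ** W) = F"
    "ln (det Sx * det (matrix_inv Sx + (1 / s2) *\<^sub>R (transpose W ** W))) / 2 = max_rate lam s2 F n"
    using rate_attained[OF water_filling n(3)] by blast
  have MI: "MI_Wb Sx s2 W b = ln (det Sx * det (matrix_inv Sx + (1 / s2) *\<^sub>R (transpose W ** W))) / 2"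
    for W :: "real^'n0^'n1" and b
    by (rule mutual_information_gaussian_channel[OF sym posdef s2_pos])
  have "MMI Sx s2 F TYPE('n1) = max_rate lam s2 F n"
    unfolding MMI_def
  \<comment> \<open>Exhibiting a maximum settles nonemptiness and boundedness, on which the meaning
    of \<open>Sup\<close> on the reals depends.\<close>
  proof (rule cSup_eq_maximum)
    \<comment> \<open>By \<open>MI\<close> the offset has no influence on the value, so
      \<open>0\<close> is as good as any other.\<close>
    have "max_rate lam s2 F n = MI_Wb Sx s2 W 0" by (simp only: MI W(2))
    then show "max_rate lam s2 F n \<in> {MI_Wb Sx s2 W b | (W :: real^'n0^'n1) (b :: real^'n1).
        trace (transpose W ** W) \<le> F}"
      using W(1) by auto
    show "y \<le> max_rate lam s2 F n"
      if y: "y \<in> {MI_Wb Sx s2 W b | (W :: real^'n0^'n1) (b :: real^'n1). trace (transpose W ** W) \<le> F}" for y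
    proof -
      obtain V :: "real^'n0^'n1" and b where V: "y = MI_Wb Sx s2 V b" "trace (transpose V ** V) \<le> F"
        using y by blast
      show ?thesis unfolding V(1) MI by (rule rate_upper_bound[OF water_filling V(2)])
    qed
  qed
  then show ?thesis by (simp add: max_rate_def n_def)
qed

end
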